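(* Let $X$ be a Hilbert $C^*$-module over a $C^*$-algebra $\mathsf{A}$ and let $T\in\mathbb{B}(\ell^2(\mathsf{A}),X)$ be a surjection. Then there exists a unique frame or outer frame $(x_n)_n$ for $X$ whose synthesis operator coincides with $T$.
   Context: $\mathsf{A}$ is an arbitrary $C^*$-algebra (not necessarily unital) with multiplier algebra $M(\mathsf{A})$. Hilbert $\mathsf{A}$-modules are right modules with inner product $\mathsf{A}$-linear in the second variable; they are not assumed full. $\mathbb{B}(X,Y)$ denotes the adjointable operators from $X$ to $Y$. $\ell^2(\mathsf{A})$ is the Hilbert $\mathsf{A}$-module of sequences $(a_n)_n$ in $\mathsf{A}$ with $\sum_n a_n^*a_n$ norm convergent, with inner product $\langle (a_n)_n,(b_n)_n\rangle=\sum_n a_n^*b_n$. $M(X)$ denotes the multiplier module of $X$: $M(X)=\mathbb{B}(\mathsf{A},X)$, a Hilbert $M(\mathsf{A})$-module with $\langle v,w\rangle=v^*w\in\mathbb{B}(\mathsf{A})=M(\mathsf{A})$, containing $X$ via $x\mapsto(a\mapsto xa)$, and $M(X)\mathsf{A}=X$; thus $\langle v,x\rangle\in\mathsf{A}$ for $v\in M(X)$, $x\in X$. ($M(X)=X$ if $\mathsf{A}$ is unital or $X$ is algebraically finitely generated.) All sequences are infinite, indexed by $\mathbb{N}$. A sequence $(x_n)_n$ in $X$ is a frame for $X$ if there are constants $A,B>0$ with $A\langle x,x\rangle\le\sum_{n=1}^\infty\langle x,x_n\rangle\langle x_n,x\rangle\le B\langle x,x\rangle$ for all $x\in X$, the series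 converging in norm. A sequence $(x_n)_n$ in $M(X)$ is an outer frame for $X$ if $x_n\in M(X)\setminus X$ for at least one $n$ and the same inequalities hold for all $x\in X$ (with norm convergence in $\mathsf{A}$) for some $A,B>0$. The analysis operator of a frame or outer frame $(x_n)_n$ is $U\in\mathbb{B}(X,\ell^2(\mathsf{A}))$, $Ux=(\langle x_n,x\rangle)_n$; the synthesis operator is its adjoint $U^*$, $U^*((a_n)_n)=\sum_{n=1}^\infty x_na_n$ (norm convergent). *)

theory Defs
  imports "HOL-Analysis.Analysis"
begin

class scaleC = scaleR +
  fixes scaleC :: "complex \<Rightarrow> 'a \<Rightarrow> 'a"  (infixr "*\<^sub>C" 75)

class complex_banach = banach + scaleC +
  assumes scaleC_add_right: "c *\<^sub>C (x + y) = c *\<^sub>C x + c *\<^sub>C y"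
    and scaleC_add_left: "(c + d) *\<^sub>C x = c *\<^sub>C x + d *\<^sub>C x"
    and scaleC_scaleC: "c *\<^sub>C d *\<^sub>C x = (c * d) *\<^sub>C x"
    and scaleC_of_real: "complex_of_real r *\<^sub>C x = r *\<^sub>R x"
    and norm_scaleC: "norm (c *\<^sub>C x) = cmod c * norm x"

text \<open>\<^class>\<open>real_normed_algebra\<close> does not require a unit.\<close>

class cstar_algebra = complex_banach + real_normed_algebra +
  fixes star :: "'a \<Rightarrow> 'a"
  assumes mult_scaleC_left: "(c *\<^sub>C x) * y = c *\<^sub>C (x * y)"
    and mult_scaleC_right: "x * (c *\<^sub>C y) = c *\<^sub>C (x * y)"
    and star_add: "star (x + y) = star x + star y"
    and star_scaleC: "star (c *\<^sub>C x) = cnj c *\<^sub>C star x"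
    and star_mult: "star (x * y) = star y * star x"
    and star_star: "star (star x) = x"
    and cstar_identity: "norm (star x * x) = (norm x)\<^sup>2"

text \<open>Positive elements are those of the form \<open>c* c\<close>.\<close>

definition cstar_le :: "'a::cstar_algebra \<Rightarrow> 'a \<Rightarrow> bool"  (infix "\<preceq>" 50) where
  "a \<preceq> b \<longleftrightarrow> (\<exists>c. b - a = star c * c)"

text \<open>A Hilbert module is a type that is complete in the norm induced by the inner product;
  definiteness of the inner product is part of the last assumption.\<close>

locale hilbert_module =
  fixes act :: "'x::complex_banach \<Rightarrow> 'a::cstar_algebra \<Rightarrow> 'x"
    and ip :: "'x \<Rightarrow> 'x \<Rightarrow> 'a"
  assumes act_add_left: "act (x + y) a = act x a + act y a"
    and act_add_right: "act x (a + b) = act x a + act x b"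
    and act_act: "act (act x a) b = act x (a * b)"
    and act_scaleC_left: "act (c *\<^sub>C x) a = c *\<^sub>C act x a"
    and act_scaleC_right: "act x (c *\<^sub>C a) = c *\<^sub>C act x a"
    and ip_add_right: "ip x (y + z) = ip x y + ip x z"
    and ip_scaleC_right: "ip x (c *\<^sub>C y) = c *\<^sub>C ip x y"
    and ip_act_right: "ip x (act y a) = ip x y * a"
    and star_ip: "star (ip x y) = ip y x"
    and ip_self_pos: "0 \<preceq> ip x x"
    and norm_eq_sqrt_ip: "norm x = sqrt (norm (ip x x))"

text \<open>Adjointability with respect to two algebra-valued inner products. Linearity and boundedness
  of adjointable maps between Hilbert modules are automatic.\<close>

definition is_adjoint ::
    "('x \<Rightarrow> 'x \<Rightarrow> 'a) \<Rightarrow> ('y \<Rightarrow> 'y \<Rightarrow> 'a) \<Rightarrow> ('x \<Rightarrow> 'y) \<Rightarrow> ('y \<Rightarrow> 'x) \<Rightarrow> bool" where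
  "is_adjoint ipX ipY T S \<longleftrightarrow> (\<forall>x y. ipY (T x) y = ipX x (S y))"

definition adjointable ::
    "('x \<Rightarrow> 'x \<Rightarrow> 'a) \<Rightarrow> ('y \<Rightarrow> 'y \<Rightarrow> 'a) \<Rightarrow> ('x \<Rightarrow> 'y) set" where
  "adjointable ipX ipY = {T. \<exists>S. is_adjoint ipX ipY T S}"

definition adjoint_op ::
    "('x \<Rightarrow> 'x \<Rightarrow> 'a) \<Rightarrow> ('y \<Rightarrow> 'y \<Rightarrow> 'a) \<Rightarrow> ('x \<Rightarrow> 'y) \<Rightarrow> ('y \<Rightarrow> 'x)" where
  "adjoint_op ipX ipY T = (THE S. is_adjoint ipX ipY T S)"

definition algebra_ip :: "'a::cstar_algebra \<Rightarrow> 'a \<Rightarrow> 'a" where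
  "algebra_ip a b = star a * b"

typedef (overloaded) 'a ell2 = "{f :: nat \<Rightarrow> 'a::cstar_algebra. summable (\<lambda>n. star (f n) * f n)}"
  by (rule exI[of _ "\<lambda>_. 0"]) simp

definition ell2_ip :: "'a::cstar_algebra ell2 \<Rightarrow> 'a ell2 \<Rightarrow> 'a" where
  "ell2_ip f g = (\<Sum>n. star (Rep_ell2 f n) * Rep_ell2 g n)"

definition multiplier_module :: "('x \<Rightarrow> 'x \<Rightarrow> 'a::cstar_algebra) \<Rightarrow> ('a \<Rightarrow> 'x) set" where
  "multiplier_module ip = adjointable algebra_ip ip"

definition mult_embed :: "('x \<Rightarrow> 'a::cstar_algebra \<Rightarrow> 'x) \<Rightarrow> 'x \<Rightarrow> ('a \<Rightarrow> 'x)" where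
  "mult_embed act x = (\<lambda>a. act x a)"

text \<open>For a multiplier \<open>v\<close> and \<open>x\<close> in the module, the inner product of \<open>v\<close> with the embedded \<open>x\<close>
  is the composite of the adjoint \<open>v*\<close> with \<open>a \<mapsto> x a\<close>, i.e. left multiplication by \<open>v* x\<close>; the
  inner product is identified with this element of the algebra, and the inner product in the
  other order with its star.\<close>

definition mult_ip :: "('x \<Rightarrow> 'x \<Rightarrow> 'a::cstar_algebra) \<Rightarrow> ('a \<Rightarrow> 'x) \<Rightarrow> 'x \<Rightarrow> 'a" where
  "mult_ip ip v x = adjoint_op algebra_ip ip v x"

definition is_frame :: "('x \<Rightarrow> 'x \<Rightarrow> 'a::cstar_algebra) \<Rightarrow> (nat \<Rightarrow> 'x) \<Rightarrow> bool" where
  "is_frame ip xs \<longleftrightarrow>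
    (\<exists>A B :: real. A > 0 \<and> B > 0 \<and>
      (\<forall>x. summable (\<lambda>n. ip x (xs n) * ip (xs n) x) \<and>
           A *\<^sub>R ip x x \<preceq> (\<Sum>n. ip x (xs n) * ip (xs n) x) \<and>
           (\<Sum>n. ip x (xs n) * ip (xs n) x) \<preceq> B *\<^sub>R ip x x))"

definition is_outer_frame ::
    "('x \<Rightarrow> 'a::cstar_algebra \<Rightarrow> 'x) \<Rightarrow> ('x \<Rightarrow> 'x \<Rightarrow> 'a) \<Rightarrow> (nat \<Rightarrow> 'a \<Rightarrow> 'x) \<Rightarrow> bool" where
  "is_outer_frame act ip v \<longleftrightarrow>
    (\<forall>n. v n \<in> multiplier_module ip) \<and>
    (\<exists>n. v n \<notin> range (mult_embed act)) \<and>
    (\<exists>A B :: real. A > 0 \<and> B > 0 \<and>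
      (\<forall>x. summable (\<lambda>n. star (mult_ip ip (v n) x) * mult_ip ip (v n) x) \<and>
           A *\<^sub>R ip x x \<preceq> (\<Sum>n. star (mult_ip ip (v n) x) * mult_ip ip (v n) x) \<and>
           (\<Sum>n. star (mult_ip ip (v n) x) * mult_ip ip (v n) x) \<preceq> B *\<^sub>R ip x x))"

text \<open>Analysis and synthesis operators are stated for sequences of multipliers; a frame enters
  through \<^const>\<open>mult_embed\<close>, and \<open>mult_ip_embed\<close> below shows that its analysis operator then
  has the coefficients \<open>ip (xs n) x\<close>.\<close>

definition analysis ::
    "('x \<Rightarrow> 'x \<Rightarrow> 'a::cstar_algebra) \<Rightarrow> (nat \<Rightarrow> 'a \<Rightarrow> 'x) \<Rightarrow> 'x \<Rightarrow> 'a ell2" where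
  "analysis ip v x = Abs_ell2 (\<lambda>n. mult_ip ip (v n) x)"

definition synthesis ::
    "('x \<Rightarrow> 'x \<Rightarrow> 'a::cstar_algebra) \<Rightarrow> (nat \<Rightarrow> 'a \<Rightarrow> 'x) \<Rightarrow> 'a ell2 \<Rightarrow> 'x" where
  "synthesis ip v = adjoint_op ip ell2_ip (analysis ip v)"

lemma algebra_ip_cancel:
  fixes b c :: "'a::cstar_algebra"
  assumes "\<And>a. algebra_ip a b = algebra_ip a c"
  shows "b = c"
proof -
  have "star (b - c) * (b - c) = 0"
    using assms[of "b - c"] by (simp add: algebra_ip_def right_diff_distrib)
  then have "(norm (b - c))\<^sup>2 = 0"
    by (metis cstar_identity norm_zero)
  then show ?thesis by simp
qed

lemma is_adjoint_adjoint_op: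
  assumes "v \<in> multiplier_module ip"
  shows "is_adjoint algebra_ip ip v (adjoint_op algebra_ip ip v)"
proof -
  obtain S where S: "is_adjoint algebra_ip ip v S"
    using assms by (auto simp: multiplier_module_def adjointable_def)
  have "S' = S" if S': "is_adjoint algebra_ip ip v S'" for S'
  proof (rule ext, rule algebra_ip_cancel)
    fix y a
    show "algebra_ip a (S' y) = algebra_ip a (S y)"
      using S S' unfolding is_adjoint_def by (metis (no_types))
  qed
  with S show ?thesis
    unfolding adjoint_op_def by (rule theI)
qed

context hilbert_module
begin

lemma is_adjoint_embed: "is_adjoint algebra_ip ip (mult_embed act x) (ip x)"
proof -
  have "ip (act x a) y = star a * ip x y" for a y
  proof -
    have "ip (act x a) y = star (ip y (act x a))" by (simp only: star_ip)
    also have "\<dots> = star a * star (ip y x)" by (simp only: ip_act_right star_mult)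
    finally show ?thesis by (simp only: star_ip)
  qed
  then show ?thesis by (simp add: is_adjoint_def algebra_ip_def mult_embed_def)
qed

lemma embed_in_multiplier_module: "mult_embed act x \<in> multiplier_module ip"
  using is_adjoint_embed by (auto simp: multiplier_module_def adjointable_def)

lemma mult_ip_embed: "mult_ip ip (mult_embed act x) y = ip x y"
proof (rule algebra_ip_cancel)
  fix a
  have "algebra_ip a (mult_ip ip (mult_embed act x) y) = ip (mult_embed act x a) y"
    using is_adjoint_adjoint_op[OF embed_in_multiplier_module[of x]]
    by (simp add: mult_ip_def is_adjoint_def)
  also have "\<dots> = algebra_ip a (ip x y)"
    using is_adjoint_embed[of x] by (simp add: is_adjoint_def)
  finally show "algebra_ip a (mult_ip ip (mult_embed act x) y) = algebra_ip a (ip x y)" .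
qed

end

end

theory Submission
  imports Defs
begin

text \<open>
  The frame vectors are forced: \<open>x\<^sub>n\<close> is the multiplier \<open>a \<mapsto> T (e\<^sub>n a)\<close>. Its
  inner product with \<open>x\<close> is the \<open>n\<close>-th entry of \<open>T* x\<close>, so the analysis operator is \<open>T*\<close> and the
  frame inequalities say \<open>A \<le> T T* \<le> B\<close>. For the upper bound, \<open>B - T T*\<close> is the square of a
  self-adjoint operator as soon as \<open>B > \<parallel>T T*\<parallel>\<close>. For the lower bound, surjectivity of \<open>T\<close> and uniform
  boundedness make \<open>T*\<close> bounded below, so that \<open>T T* - A\<close> has no negative part for small \<open>A\<close>.

  All of this rests on the positivity of \<open>c* c\<close> in a \<open>C*\<close>-algebra, equivalently on
  Cauchy--Schwarz in \<open>\<ell>\<^sup>2\<close>. No spectral theory is used: a self-adjoint operator is positive if it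
  satisfies \<open>\<parallel>t - K\<parallel> \<le> t\<close> for some \<open>t\<close>, square roots come from the iteration
  \<open>Y \<mapsto> (Z + Y\<^sup>2) / 2\<close> for \<open>1 - \<surd>(1 - Z)\<close>, and an element of the algebra is positive if left
  multiplication by it is a positive operator.
\<close>

subsection \<open>Inner products with values in a C*-algebra\<close>

lemma scaleC_one: "1 *\<^sub>C x = (x :: 'x::complex_banach)"
  using scaleC_of_real[of 1 x] by simp

lemma scaleC_minus_one: "(- 1) *\<^sub>C x = - (x :: 'x::complex_banach)"
  using scaleC_of_real[of "- 1" x] by simp

lemma scaleC_minus_left: "(- c) *\<^sub>C x = - (c *\<^sub>C (x :: 'x::complex_banach))"
  using scaleC_scaleC[of "- 1" c x] by (simp add: scaleC_minus_one)

lemma scaleC_minus_right: "c *\<^sub>C (- x) = - (c *\<^sub>C (x :: 'x::complex_banach))"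
  using scaleC_scaleC[of c "- 1" x] by (simp add: scaleC_minus_one scaleC_minus_left scaleC_one)

lemma scaleC_diff_right: "c *\<^sub>C (x - y) = c *\<^sub>C x - c *\<^sub>C (y :: 'x::complex_banach)"
  using scaleC_add_right[of c x "- y"] by (simp add: scaleC_minus_right)

lemma scaleC_scaleR: "c *\<^sub>C (r *\<^sub>R x) = r *\<^sub>R (c *\<^sub>C (x :: 'x::complex_banach))"
  by (simp only: scaleC_of_real[symmetric] scaleC_scaleC mult.commute)

lemma bounded_linear_scaleC: "bounded_linear (\<lambda>x :: 'x::complex_banach. c *\<^sub>C x)"
  by (rule bounded_linear_intro[where K = "cmod c"])
    (simp_all add: scaleC_add_right scaleC_scaleR norm_scaleC)

lemma star_scaleR: "star (r *\<^sub>R a) = r *\<^sub>R star (a :: 'a::cstar_algebra)"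
  using star_scaleC[of "complex_of_real r" a] by (simp add: scaleC_of_real)

text \<open>The C*-identity and submultiplicativity give \<open>norm b \<le> norm (star b)\<close>;
  used for \<open>a\<close> and for \<open>star a\<close>, this becomes an equality.\<close>

lemma norm_star: "norm (star a) = norm (a :: 'a::cstar_algebra)"
proof -
  have le: "norm b \<le> norm (star b)" for b :: 'a
  proof (cases "b = 0")
    case False
    have "norm b * norm b = norm (star b * b)"
      by (simp add: cstar_identity power2_eq_square)
    also have "\<dots> \<le> norm (star b) * norm b" by (rule norm_mult_ineq)
    finally show ?thesis using False by simp
  qed simp
  show ?thesis using le[of a] le[of "star a"] by (simp add: star_star)
qed

lemma bounded_linear_star: "bounded_linear (star :: 'a::cstar_algebra \<Rightarrow> 'a)"
  by (rule bounded_linear_intro[where K = 1]) (simp_all add: star_add star_scaleR norm_star)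

lemmas star_zero = linear_0[OF bounded_linear.linear[OF bounded_linear_star]]
  and star_diff = linear_diff[OF bounded_linear.linear[OF bounded_linear_star]]
  and star_sum = linear_sum[OF bounded_linear.linear[OF bounded_linear_star]]

section \<open>Calculus of the algebra-valued inner product\<close>

context hilbert_module
begin

lemma norm_power2: "(norm x)\<^sup>2 = norm (ip x x)"
  by (subst norm_eq_sqrt_ip) simp

lemma ip_add_left: "ip (x + y) z = ip x z + ip y z"
  by (metis star_ip ip_add_right star_add)

lemma ip_scaleC_left: "ip (c *\<^sub>C x) y = cnj c *\<^sub>C ip x y"
  by (metis star_ip ip_scaleC_right star_scaleC)

lemma ip_act_left: "ip (act x a) y = star a * ip x y"
  by (metis star_ip ip_act_right star_mult)

lemma ip_scaleR_right: "ip x (r *\<^sub>R y) = r *\<^sub>R ip x y"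
  by (simp add: scaleC_of_real[symmetric] ip_scaleC_right)

lemma ip_scaleR_left: "ip (r *\<^sub>R x) y = r *\<^sub>R ip x y"
  by (simp add: scaleC_of_real[symmetric] ip_scaleC_left)

lemma ip_minus_right: "ip x (- y) = - ip x y"
  using ip_scaleR_right[of x "- 1" y] by simp

lemma ip_minus_left: "ip (- x) y = - ip x y"
  using ip_scaleR_left[of "- 1" x y] by simp

lemma ip_diff_right: "ip x (y - z) = ip x y - ip x z"
  using ip_add_right[of x y "- z"] by (simp add: ip_minus_right)

lemma ip_diff_left: "ip (x - y) z = ip x z - ip y z"
  using ip_add_left[of x "- y" z] by (simp add: ip_minus_left)

lemma ip_zero_right [simp]: "ip x 0 = 0"
  using ip_diff_right[of x 0 0] by simp

lemma ip_zero_left [simp]: "ip 0 x = 0"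
  using ip_diff_left[of 0 0 x] by simp

lemma ip_self_eq_0: "ip x x = 0 \<Longrightarrow> x = 0"
  using norm_power2[of x] by simp

lemma ip_ext:
  assumes "\<And>z. ip z x = ip z y"
  shows "x = y"
  using ip_self_eq_0[of "x - y"] assms by (simp add: ip_diff_right)

text \<open>The inner squares of \<open>x + z\<close> and \<open>x - z\<close> differ by twice
  \<open>ip x z + ip z x\<close>; the choices \<open>z = y\<close> and
  \<open>z = \<i> *\<^sub>C y\<close> isolate \<open>ip x y\<close>.\<close>

lemma polarization:
  "4 *\<^sub>R ip x y = (ip (x + y) (x + y) - ip (x - y) (x - y)) -
     \<i> *\<^sub>C (ip (x + \<i> *\<^sub>C y) (x + \<i> *\<^sub>C y) - ip (x - \<i> *\<^sub>C y) (x - \<i> *\<^sub>C y))"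
proof -
  have *: "ip (x + z) (x + z) - ip (x - z) (x - z) = 2 *\<^sub>R (ip x z + ip z x)" for z
    by (simp add: ip_add_left ip_add_right ip_diff_left ip_diff_right scaleR_2)
  have "\<i> *\<^sub>C (2 *\<^sub>R (ip x (\<i> *\<^sub>C y) + ip (\<i> *\<^sub>C y) x)) = 2 *\<^sub>R (ip y x - ip x y)"
    by (simp add: ip_scaleC_left ip_scaleC_right scaleC_add_right scaleC_scaleR scaleC_scaleC
        scaleC_one scaleC_minus_one)
  moreover have "4 *\<^sub>R ip x y = 2 *\<^sub>R ip x y + 2 *\<^sub>R ip x y"
    by (simp flip: scaleR_add_left)
  ultimately show ?thesis
    unfolding * by (simp add: scaleR_add_right scaleR_diff_right)
qed

text \<open>The sharp Cauchy--Schwarz inequality needs the order of the algebra; the triangle inequality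
  of the norm already gives it up to a constant.\<close>

lemma norm_ip_le_4: "norm (ip x y) \<le> norm x * norm y * 4"
proof (cases "x = 0 \<or> y = 0")
  case False
  have *: "norm (ip x z) \<le> (norm x + norm z)\<^sup>2" for z
  proof -
    have q: "norm (ip w w) \<le> (norm x + norm z)\<^sup>2" if "norm w \<le> norm x + norm z" for w
      using that by (simp add: norm_power2[symmetric] power_mono)
    have nz: "norm (\<i> *\<^sub>C z) = norm z" by (simp add: norm_scaleC)
    have "norm (4 *\<^sub>R ip x z) \<le> norm (ip (x + z) (x + z)) + norm (ip (x - z) (x - z)) +
      (norm (ip (x + \<i> *\<^sub>C z) (x + \<i> *\<^sub>C z)) + norm (ip (x - \<i> *\<^sub>C z) (x - \<i> *\<^sub>C z)))"
      unfolding polarization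
      by (intro norm_triangle_le_diff add_mono norm_triangle_ineq4)
        (simp add: norm_scaleC norm_triangle_ineq4)
    also have "\<dots> \<le> (norm x + norm z)\<^sup>2 + (norm x + norm z)\<^sup>2 +
      ((norm x + norm z)\<^sup>2 + (norm x + norm z)\<^sup>2)"
      by (intro add_mono q) (metis norm_triangle_ineq norm_triangle_ineq4 nz)+
    finally show ?thesis by simp
  qed
  \<comment> \<open>The bound \<open>*\<close> is quadratic in \<open>norm x + norm z\<close>;
    scaling \<open>y\<close> to the length of \<open>x\<close> turns it into a multiple of the
    product of the norms.\<close>
  define r where "r = norm x / norm y"
  have r: "r > 0" "r * norm y = norm x" using False by (auto simp: r_def)
  have "r * norm (ip x y) \<le> (norm x + norm x)\<^sup>2"
    using *[of "r *\<^sub>R y"] r by (simp add: ip_scaleR_right)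
  also have "\<dots> = r * (norm x * norm y * 4)"
    using r(2) by (simp add: power2_eq_square algebra_simps)
  finally show ?thesis using r(1) by simp
qed auto

lemma bounded_bilinear_ip: "bounded_bilinear ip"
  by standard (auto simp: ip_add_left ip_add_right ip_scaleR_left ip_scaleR_right
      intro!: exI[of _ 4] norm_ip_le_4)

end

subsection \<open>Positive operators on a Hilbert module\<close>

text \<open>\<open>K\<close> is taken as a real bounded operator so that norms and limits are
  available; complex linearity follows from having an adjoint.\<close>

definition selfadj :: "('x \<Rightarrow> 'x \<Rightarrow> 'a) \<Rightarrow> ('x::real_normed_vector \<Rightarrow>\<^sub>L 'x) \<Rightarrow> bool" where
  "selfadj ip K \<longleftrightarrow> is_adjoint ip ip (blinfun_apply K) (blinfun_apply K)"

text \<open>For a self-adjoint \<open>K\<close> this norm condition says that the spectrum lies in \<open>[0, 2 t]\<close>.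
  In this form the positive operators are visibly closed under addition.\<close>

definition positive_op :: "('x \<Rightarrow> 'x \<Rightarrow> 'a) \<Rightarrow> ('x::real_normed_vector \<Rightarrow>\<^sub>L 'x) \<Rightarrow> bool" where
  "positive_op ip K \<longleftrightarrow> selfadj ip K \<and> (\<exists>t\<ge>0. norm (t *\<^sub>R id_blinfun - K) \<le> t)"

text \<open>The norms of the iterates are dominated by the same iteration for the number \<open>Z = 1\<close>.\<close>

lemma blinfun_sqrt_fixpoint:
  fixes Z :: "'x::banach \<Rightarrow>\<^sub>L 'x"
  assumes Z: "norm Z \<le> 1"
  obtains F Y where "F 0 = 0" "\<And>n. F (Suc n) = (1/2) *\<^sub>R (Z + (F n o\<^sub>L F n))" "F \<longlonglongrightarrow> Y"
    "norm Y \<le> 1" "Y = (1/2) *\<^sub>R (Z + (Y o\<^sub>L Y))"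
proof -
  define F where "F = rec_nat 0 (\<lambda>_ Y. (1/2) *\<^sub>R (Z + (Y o\<^sub>L Y)))"
  define y :: "nat \<Rightarrow> real" where "y = rec_nat 0 (\<lambda>_ y. (1/2) * (1 + y * y))"
  have F0: "F 0 = 0" and FS: "F (Suc n) = (1/2) *\<^sub>R (Z + (F n o\<^sub>L F n))" for n
    by (simp_all add: F_def)
  have y0: "y 0 = 0" and yS: "y (Suc n) = (1/2) * (1 + y n * y n)" for n
    by (simp_all add: y_def)
  have y01: "0 \<le> y n \<and> y n \<le> 1" for n
  proof (induction n)
    case (Suc n)
    then have "y n * y n \<le> 1 * 1" by (intro mult_mono) auto
    with Suc show ?case by (simp add: yS)
  qed (simp add: y0)
  have nF: "norm (F n) \<le> y n" for n
  proof (induction n)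
    case (Suc n)
    have "norm (F n o\<^sub>L F n) \<le> y n * y n"
      using Suc y01[of n] by (intro order_trans[OF norm_blinfun_compose] mult_mono) auto
    with Z show ?case
      unfolding FS yS by (simp add: norm_triangle_mono)
  qed (simp add: F0 y0)
  \<comment> \<open>Since \<open>y\<close> increases and is bounded by 1, its increments are
    summable and dominate those of \<open>F\<close>.\<close>
  have dF: "norm (F (Suc n) - F n) \<le> y (Suc n) - y n" for n
  proof (induction n)
    case 0
    show ?case using nF[of "Suc 0"] by (simp add: F0 y0)
  next
    case (Suc n)
    let ?D = "F (Suc n) - F n"
    \<comment> \<open>In this order of factors the difference of two squares splits without any
      commutation.\<close>
    have eq: "F (Suc (Suc n)) - F (Suc n) = (1/2) *\<^sub>R ((?D o\<^sub>L F (Suc n)) + (F n o\<^sub>L ?D))"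
    proof -
      have "F (Suc (Suc n)) - F (Suc n) = (1/2) *\<^sub>R (Z + (F (Suc n) o\<^sub>L F (Suc n))) -
          (1/2) *\<^sub>R (Z + (F n o\<^sub>L F n))"
        by (rule arg_cong2[of _ _ _ _ minus, OF FS FS])
      also have "\<dots> = (1/2) *\<^sub>R ((F (Suc n) o\<^sub>L F (Suc n)) - (F n o\<^sub>L F n))"
        by (simp add: algebra_simps)
      also have "(F (Suc n) o\<^sub>L F (Suc n)) - (F n o\<^sub>L F n) = (?D o\<^sub>L F (Suc n)) + (F n o\<^sub>L ?D)"
        by (rule blinfun_eqI) (simp add: blinfun.bilinear_simps)
      finally show ?thesis .
    qed
    have d0: "0 \<le> y (Suc n) - y n" using Suc norm_ge_zero order_trans by blast
    have "norm (?D o\<^sub>L F (Suc n)) \<le> (y (Suc n) - y n) * y (Suc n)"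
      using Suc nF[of "Suc n"] by (intro order_trans[OF norm_blinfun_compose] mult_mono) (use y01 d0 in auto)
    moreover have "norm (F n o\<^sub>L ?D) \<le> y n * (y (Suc n) - y n)"
      using Suc nF[of n] by (intro order_trans[OF norm_blinfun_compose] mult_mono) (use y01 d0 in auto)
    ultimately have "norm ((?D o\<^sub>L F (Suc n)) + (F n o\<^sub>L ?D)) \<le> y (Suc n) * y (Suc n) - y n * y n"
      by (intro norm_triangle_le) (simp add: algebra_simps)
    moreover have "y (Suc (Suc n)) - y (Suc n) = (1/2) * (y (Suc n) * y (Suc n) - y n * y n)"
      using yS[of n] yS[of "Suc n"] by simp
    ultimately show ?case
      unfolding eq by simp
  qed
  have inc: "incseq y"
    using dF by (intro incseq_SucI) (smt (verit) norm_ge_zero)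
  then obtain l where l: "y \<longlonglongrightarrow> l"
    using y01 by (metis incseq_convergent)
  have "summable (\<lambda>n. F (Suc n) - F n)"
    by (rule summable_comparison_test'[OF telescope_summable[OF l], where N = 0]) (rule dF)
  then obtain s where "(\<lambda>n. F (Suc n) - F n) sums s" by (auto simp: summable_def)
  then have Fs: "F \<longlonglongrightarrow> s"
    by (simp add: sums_def sum_lessThan_telescope F0)
  have "(\<lambda>n. (1/2) *\<^sub>R (Z + (F n o\<^sub>L F n))) \<longlonglongrightarrow> (1/2) *\<^sub>R (Z + (s o\<^sub>L s))"
    by (intro tendsto_intros bounded_bilinear.tendsto[OF bounded_bilinear_blinfun_compose] Fs)
  moreover have "(\<lambda>n. (1/2) *\<^sub>R (Z + (F n o\<^sub>L F n))) \<longlonglongrightarrow> s"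
    using LIMSEQ_Suc[OF Fs] by (simp add: FS)
  ultimately have "s = (1/2) *\<^sub>R (Z + (s o\<^sub>L s))" by (rule LIMSEQ_unique[rotated])
  moreover have "norm s \<le> 1"
    by (rule LIMSEQ_le_const2[OF tendsto_norm[OF Fs]]) (meson nF y01 order_trans)
  ultimately show thesis using F0 FS Fs by (intro that[of F s])
qed

section \<open>Self-adjoint operators and their square roots\<close>

context hilbert_module
begin

lemma selfadj_ip:
  fixes K :: "'x \<Rightarrow>\<^sub>L 'x"
  shows "selfadj ip K \<Longrightarrow> ip (K x) y = ip x (K y)"
  by (simp add: selfadj_def is_adjoint_def)

lemma selfadjI:
  fixes K :: "'x \<Rightarrow>\<^sub>L 'x"
  shows "(\<And>x y. ip (K x) y = ip x (K y)) \<Longrightarrow> selfadj ip K"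
  by (simp add: selfadj_def is_adjoint_def)

lemma selfadj_id: "selfadj ip id_blinfun"
  and selfadj_zero: "selfadj ip 0"
  by (auto intro: selfadjI)

lemma selfadj_add: "selfadj ip K \<Longrightarrow> selfadj ip L \<Longrightarrow> selfadj ip (K + L)"
  and selfadj_diff: "selfadj ip K \<Longrightarrow> selfadj ip L \<Longrightarrow> selfadj ip (K - L)"
  and selfadj_scaleR: "selfadj ip K \<Longrightarrow> selfadj ip (r *\<^sub>R K)"
  by (auto intro!: selfadjI simp: blinfun.bilinear_simps ip_add_left ip_add_right ip_diff_left
      ip_diff_right ip_scaleR_left ip_scaleR_right selfadj_ip)

lemma selfadj_compose:
  fixes K L :: "'x \<Rightarrow>\<^sub>L 'x"
  assumes "selfadj ip K" "selfadj ip L" "\<And>x. K (L x) = L (K x)"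
  shows "selfadj ip (K o\<^sub>L L)"
  by (rule selfadjI) (simp add: selfadj_ip assms)

lemma selfadj_limit:
  assumes "\<And>n. selfadj ip (F n)" "F \<longlonglongrightarrow> K"
  shows "selfadj ip K"
proof (rule selfadjI)
  fix x y
  have F: "(\<lambda>n. blinfun_apply (F n) z) \<longlonglongrightarrow> K z" for z
    by (intro tendsto_intros assms)
  have "(\<lambda>n. ip (F n x) y) \<longlonglongrightarrow> ip (K x) y"
    by (intro bounded_bilinear.tendsto[OF bounded_bilinear_ip] F tendsto_const)
  moreover have "(\<lambda>n. ip (F n x) y) \<longlonglongrightarrow> ip x (K y)"
    by (subst selfadj_ip[OF assms(1)])
      (intro bounded_bilinear.tendsto[OF bounded_bilinear_ip] F tendsto_const)
  ultimately show "ip (K x) y = ip x (K y)" by (rule LIMSEQ_unique)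
qed

text \<open>By self-adjointness \<open>ip (K x) (K x) = ip x (K (K x))\<close>, and the inner
  product is definite.\<close>

lemma selfadj_square_eq_0:
  fixes K :: "'x \<Rightarrow>\<^sub>L 'x"
  assumes "selfadj ip K" "\<And>x. K (K x) = 0"
  shows "K = 0"
proof (rule blinfun_eqI)
  fix x
  have "ip (K x) (K x) = 0" by (simp add: selfadj_ip assms)
  then show "blinfun_apply K x = blinfun_apply 0 x" using ip_self_eq_0 by simp
qed

lemma positive_op_selfadj: "positive_op ip K \<Longrightarrow> selfadj ip K"
  by (simp add: positive_op_def)

lemma positive_op_zero: "positive_op ip 0"
  unfolding positive_op_def by (intro conjI selfadj_zero exI[of _ 0]) auto

text \<open>If \<open>Y\<close> equals half of \<open>Z\<close> plus its own square, then
  \<open>1 - Y\<close> squares to \<open>1 - Z\<close>; scaling by \<open>sqrt t\<close> gives a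
  root of \<open>K\<close>. The root is a limit of polynomials in \<open>Z\<close>, so it commutes
  with whatever commutes with \<open>K\<close>.\<close>

lemma op_sqrt:
  fixes K :: "'x \<Rightarrow>\<^sub>L 'x"
  assumes K: "selfadj ip K" and t: "norm (t *\<^sub>R id_blinfun - K) \<le> t"
  obtains S where "positive_op ip S" "\<And>x. S (S x) = K x"
    "\<forall>W :: 'x \<Rightarrow>\<^sub>L 'x. (\<forall>x. W (K x) = K (W x)) \<longrightarrow> (\<forall>x. W (S x) = S (W x))"
proof (cases "t = 0")
  case True
  then have "K = 0" using t by simp
  then show ?thesis using that[of 0] by (simp add: positive_op_zero)
next
  case False
  have t0: "t > 0" using False t norm_ge_zero[of "t *\<^sub>R id_blinfun - K"] by linarith
  define Z where "Z = id_blinfun - (1/t) *\<^sub>R K"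
  have KZ: "K = t *\<^sub>R (id_blinfun - Z)" using t0 by (simp add: Z_def)
  have "t *\<^sub>R Z = t *\<^sub>R id_blinfun - K" using t0 by (simp add: Z_def scaleR_diff_right)
  then have "t * norm Z \<le> t" using t t0 by (metis norm_scaleR abs_of_pos)
  then have "norm Z \<le> 1" using t0 by simp
  then obtain F Y where F: "F 0 = 0" "\<And>n. F (Suc n) = (1/2) *\<^sub>R (Z + (F n o\<^sub>L F n))" "F \<longlonglongrightarrow> Y"
    and Y: "norm Y \<le> 1" "Y = (1/2) *\<^sub>R (Z + (Y o\<^sub>L Y))"
    using blinfun_sqrt_fixpoint by blast
  have sZ: "selfadj ip Z" unfolding Z_def by (intro selfadj_diff selfadj_scaleR selfadj_id K)
  have sF: "selfadj ip (F n)" for n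
    by (induction n) (simp_all add: F selfadj_zero selfadj_scaleR selfadj_add sZ selfadj_compose)
  have sY: "selfadj ip Y" by (rule selfadj_limit[OF sF F(3)])
  define S where "S = sqrt t *\<^sub>R (id_blinfun - Y)"
  show ?thesis
  proof (rule that[of S])
    \<comment> \<open>Because \<open>norm Y \<le> 1\<close>, the number \<open>sqrt t\<close>
      witnesses the positivity of \<open>S\<close>.\<close>
    have "norm (sqrt t *\<^sub>R id_blinfun - S) = sqrt t * norm Y"
      using t0 by (simp add: S_def scaleR_diff_right)
    also have "\<dots> \<le> sqrt t" using Y(1) t0 by (simp add: mult_left_le)
    finally show "positive_op ip S"
      using t0 by (auto simp: positive_op_def S_def selfadj_id sY
          intro!: selfadj_scaleR selfadj_diff exI[of _ "sqrt t"])
    show "S (S x) = K x" for x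
    proof -
      have "Y x = (1/2) *\<^sub>R (Z x + Y (Y x))"
        using arg_cong[OF Y(2), of "\<lambda>A. blinfun_apply A x"] by (simp add: blinfun.bilinear_simps)
      from arg_cong[OF this, of "\<lambda>y. 2 *\<^sub>R y"] have "Y x + Y x = Z x + Y (Y x)"
        by (simp add: scaleR_2)
      then have "x - Y x - (Y x - Y (Y x)) = x - Z x" by (simp add: algebra_simps)
      moreover have "S (S x) = t *\<^sub>R (x - Y x - (Y x - Y (Y x)))"
        using t0 by (simp add: S_def blinfun.bilinear_simps) (simp flip: scaleR_diff_right)
      ultimately show ?thesis
        by (simp only: KZ blinfun.bilinear_simps blinfun_apply_id_blinfun)
    qed
    show "\<forall>W :: 'x \<Rightarrow>\<^sub>L 'x. (\<forall>x. W (K x) = K (W x)) \<longrightarrow> (\<forall>x. W (S x) = S (W x))"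
    proof (intro allI impI)
      fix W :: "'x \<Rightarrow>\<^sub>L 'x" and x
      assume WK: "\<forall>x. W (K x) = K (W x)"
      have WZ: "W (Z x) = Z (W x)" for x by (simp add: Z_def blinfun.bilinear_simps WK)
      have WF: "W (F n x) = F n (W x)" for n x
        by (induction n arbitrary: x) (simp_all add: F blinfun.bilinear_simps WZ)
      have FY: "(\<lambda>n. blinfun_apply (F n) z) \<longlonglongrightarrow> Y z" for z
        by (intro tendsto_intros F(3))
      have "(\<lambda>n. W (F n x)) \<longlonglongrightarrow> W (Y x)"
        by (intro bounded_linear.tendsto[OF blinfun.bounded_linear_right] FY)
      then have "W (Y x) = Y (W x)"
        unfolding WF using FY[of "W x"] LIMSEQ_unique by blast
      then show "W (S x) = S (W x)" by (simp add: S_def blinfun.bilinear_simps)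
    qed
  qed
qed

text \<open>The operator \<open>h \<plusminus> \<i> s\<close> is \<open>\<surd>M\<close> times an isometry, and \<open>s\<close> is a combination of the two.\<close>

lemma norm_le_if_sum_squares:
  fixes h s :: "'x \<Rightarrow>\<^sub>L 'x"
  assumes h: "selfadj ip h" and s: "selfadj ip s" and comm: "\<And>x. h (s x) = s (h x)"
    and M: "\<And>x. h (h x) + s (s x) = M *\<^sub>R x" "M \<ge> 0"
  shows "norm s \<le> sqrt M"
proof (rule norm_blinfun_bound)
  fix x
  have n: "norm (h x + c *\<^sub>C s x) = sqrt M * norm x" if "c * c = - 1" "cnj c = - c" for c
  proof -
    have "ip (h x) (h x) + ip (s x) (s x) = M *\<^sub>R ip x x"
      by (simp add: selfadj_ip[OF h] selfadj_ip[OF s] M flip: ip_add_right ip_scaleR_right)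
    moreover have "ip (h x) (s x) = ip (s x) (h x)"
      by (simp add: selfadj_ip[OF h] selfadj_ip[OF s] comm)
    ultimately have "ip (h x + c *\<^sub>C s x) (h x + c *\<^sub>C s x) = M *\<^sub>R ip x x"
      using that by (simp add: ip_add_left ip_add_right ip_scaleC_left ip_scaleC_right
          scaleC_scaleC scaleC_minus_left scaleC_diff_right scaleC_one scaleC_minus_one)
    then have "(norm (h x + c *\<^sub>C s x))\<^sup>2 = (sqrt M * norm x)\<^sup>2"
      using M(2) by (simp add: norm_power2 power_mult_distrib)
    then show ?thesis using M(2) by (simp add: power2_eq_iff_nonneg)
  qed
  have "2 *\<^sub>R (\<i> *\<^sub>C s x) = (h x + \<i> *\<^sub>C s x) - (h x + (- \<i>) *\<^sub>C s x)"
    by (simp add: scaleC_minus_left scaleR_2)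
  then have "norm (2 *\<^sub>R (\<i> *\<^sub>C s x)) \<le> norm (h x + \<i> *\<^sub>C s x) + norm (h x + (- \<i>) *\<^sub>C s x)"
    using norm_triangle_ineq4 by metis
  then have "norm (2 *\<^sub>R (\<i> *\<^sub>C s x)) \<le> 2 * (sqrt M * norm x)"
    by (simp add: n)
  then show "norm (s x) \<le> sqrt M * norm x" by (simp add: norm_scaleC)
qed (simp add: M)

text \<open>Subtracting \<open>M - h\<^sup>2\<close> from \<open>M\<close> leaves
  \<open>h\<^sup>2\<close>, of norm at most \<open>M\<close>, so \<open>op_sqrt\<close> yields a
  root \<open>r\<close> of \<open>M - h\<^sup>2\<close>. It commutes with \<open>h\<close>, and
  \<open>h\<^sup>2 + r\<^sup>2 = M\<close> bounds the norm of \<open>r\<close> by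
  \<open>sqrt M\<close>.\<close>

lemma norm_diff_square_le:
  fixes h :: "'x \<Rightarrow>\<^sub>L 'x"
  assumes h: "selfadj ip h" and M: "norm (h o\<^sub>L h) \<le> M"
  shows "norm (M *\<^sub>R id_blinfun - (h o\<^sub>L h)) \<le> M"
proof -
  let ?L = "M *\<^sub>R id_blinfun - (h o\<^sub>L h)"
  have M0: "M \<ge> 0" using M norm_ge_zero order_trans by blast
  have "selfadj ip ?L" by (intro selfadj_diff selfadj_scaleR selfadj_id selfadj_compose h) simp
  moreover have "norm (M *\<^sub>R id_blinfun - ?L) \<le> M" using M by simp
  ultimately obtain r where r: "positive_op ip r" "\<And>x. r (r x) = ?L x"
    and rc: "\<forall>W :: 'x \<Rightarrow>\<^sub>L 'x. (\<forall>x. W (?L x) = ?L (W x)) \<longrightarrow> (\<forall>x. W (r x) = r (W x))"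
    by (rule op_sqrt) blast
  have "h (r x) = r (h x)" for x by (rule rc[rule_format]) (simp add: blinfun.bilinear_simps)
  then have nr: "norm r \<le> sqrt M"
    using r(1) M0 by (intro norm_le_if_sum_squares[OF h positive_op_selfadj])
      (auto simp: r(2) blinfun.bilinear_simps)
  have "?L = (r o\<^sub>L r)" by (rule blinfun_eqI) (simp only: r(2) blinfun_apply_blinfun_compose)
  then have "norm ?L \<le> norm r * norm r" by (simp only: norm_blinfun_compose)
  also have "\<dots> \<le> sqrt M * sqrt M" using nr M0 by (intro mult_mono) auto
  finally show ?thesis using M0 by simp
qed

section \<open>Cone, limit and norm properties of positive operators\<close>

lemma positive_op_square: "selfadj ip h \<Longrightarrow> positive_op ip (h o\<^sub>L h)"
  unfolding positive_op_def
  by (intro conjI selfadj_compose exI[of _ "norm (h o\<^sub>L h)"] norm_diff_square_le) auto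

lemma positive_op_sqrt:
  fixes K :: "'x \<Rightarrow>\<^sub>L 'x"
  assumes K: "positive_op ip K"
  obtains S where "positive_op ip S" "S o\<^sub>L S = K"
    "\<forall>W :: 'x \<Rightarrow>\<^sub>L 'x. (\<forall>x. W (K x) = K (W x)) \<longrightarrow> (\<forall>x. W (S x) = S (W x))"
proof -
  from K obtain t where "selfadj ip K" "norm (t *\<^sub>R id_blinfun - K) \<le> t"
    by (auto simp: positive_op_def)
  then obtain S where S: "positive_op ip S" "\<And>x. S (S x) = K x"
    "\<forall>W :: 'x \<Rightarrow>\<^sub>L 'x. (\<forall>x. W (K x) = K (W x)) \<longrightarrow> (\<forall>x. W (S x) = S (W x))"
    by (rule op_sqrt) blast
  have "S o\<^sub>L S = K" by (rule blinfun_eqI) (simp add: S(2))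
  with S show ?thesis by (intro that[of S])
qed

text \<open>Positivity provides the norm condition for one \<open>t\<close>; being a square,
  \<open>K\<close> satisfies it for every \<open>M \<ge> norm K\<close>. This allows a common
  constant for a bounded family.\<close>

lemma positive_op_norm_diff_le:
  assumes "positive_op ip K" "norm K \<le> M"
  shows "norm (M *\<^sub>R id_blinfun - K) \<le> M"
proof -
  obtain S where "positive_op ip S" "S o\<^sub>L S = K" using positive_op_sqrt[OF assms(1)] by metis
  then show ?thesis using assms(2) norm_diff_square_le[OF positive_op_selfadj] by metis
qed

lemma positive_op_add:
  assumes "positive_op ip K" "positive_op ip L"
  shows "positive_op ip (K + L)"
proof -
  obtain s t where "s \<ge> 0" "t \<ge> 0" and st: "norm (s *\<^sub>R id_blinfun - K) \<le> s" "norm (t *\<^sub>R id_blinfun - L) \<le> t"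
    using assms by (auto simp: positive_op_def)
  have "(s + t) *\<^sub>R id_blinfun - (K + L) = (s *\<^sub>R id_blinfun - K) + (t *\<^sub>R id_blinfun - L)"
    by (simp add: algebra_simps)
  then have "norm ((s + t) *\<^sub>R id_blinfun - (K + L)) \<le> s + t"
    using st by (simp only: norm_triangle_mono)
  with \<open>s \<ge> 0\<close> \<open>t \<ge> 0\<close> show ?thesis
    using assms by (auto simp: positive_op_def selfadj_add intro!: exI[of _ "s + t"])
qed

lemma positive_op_scaleR:
  assumes "positive_op ip K" "r \<ge> 0"
  shows "positive_op ip (r *\<^sub>R K)"
proof -
  obtain t where "t \<ge> 0" and t: "norm (t *\<^sub>R id_blinfun - K) \<le> t"
    using assms by (auto simp: positive_op_def)
  have "(r * t) *\<^sub>R id_blinfun - r *\<^sub>R K = r *\<^sub>R (t *\<^sub>R id_blinfun - K)"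
    by (simp add: algebra_simps)
  then have "norm ((r * t) *\<^sub>R id_blinfun - r *\<^sub>R K) \<le> r * t"
    using t assms(2) by (simp only: norm_scaleR abs_of_nonneg mult_left_mono)
  with \<open>t \<ge> 0\<close> show ?thesis
    using assms by (auto simp: positive_op_def selfadj_scaleR intro!: exI[of _ "r * t"])
qed

text \<open>A convergent sequence is bounded, so one \<open>M\<close> serves all its terms and the
  norm condition passes to the limit.\<close>

lemma positive_op_limit:
  assumes F: "\<And>n. positive_op ip (F n)" and lim: "F \<longlonglongrightarrow> K"
  shows "positive_op ip K"
proof -
  obtain M where M: "\<And>n. norm (F n) \<le> M"
    using convergent_imp_Bseq[OF convergentI[OF lim]] by (auto simp: Bseq_def)
  have "(\<lambda>n. norm (M *\<^sub>R id_blinfun - F n)) \<longlonglongrightarrow> norm (M *\<^sub>R id_blinfun - K)"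
    by (intro tendsto_intros lim)
  then have "norm (M *\<^sub>R id_blinfun - K) \<le> M"
    by (rule LIMSEQ_le_const2) (blast intro: positive_op_norm_diff_le F M)
  moreover have "M \<ge> 0" using M norm_ge_zero order_trans by blast
  ultimately show ?thesis
    using selfadj_limit[OF _ lim] F by (auto simp: positive_op_def)
qed

text \<open>The operator \<open>norm L - K\<close> is positive, as the sum of
  \<open>norm L - L\<close> and \<open>L - K\<close>. Its root \<open>r\<close> and the root
  \<open>s\<close> of \<open>K\<close> commute and satisfy
  \<open>r\<^sup>2 + s\<^sup>2 = norm L\<close>, which bounds \<open>s\<close>.\<close>

lemma positive_op_norm_mono:
  assumes K: "positive_op ip K" and L: "positive_op ip (L - K)"
  shows "norm K \<le> norm L"
proof -
  let ?M = "norm L"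
  have "selfadj ip L"
    using selfadj_add[OF positive_op_selfadj[OF K] positive_op_selfadj[OF L]] by simp
  then have "positive_op ip (?M *\<^sub>R id_blinfun - L)"
    by (auto simp: positive_op_def intro!: selfadj_diff selfadj_scaleR selfadj_id exI[of _ ?M])
  from positive_op_add[OF this L] have "positive_op ip (?M *\<^sub>R id_blinfun - K)" by simp
  then obtain r where r: "positive_op ip r" "(r o\<^sub>L r) = ?M *\<^sub>R id_blinfun - K"
    and rc: "\<forall>W :: 'x \<Rightarrow>\<^sub>L 'x. (\<forall>x. W ((?M *\<^sub>R id_blinfun - K) x) = (?M *\<^sub>R id_blinfun - K) (W x))
      \<longrightarrow> (\<forall>x. W (r x) = r (W x))"
    by (rule positive_op_sqrt) blast
  obtain s where s: "positive_op ip s" "(s o\<^sub>L s) = K" using positive_op_sqrt[OF K] by metis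
  have rr: "r (r x) = ?M *\<^sub>R x - K x" for x
    using arg_cong[OF r(2), of "\<lambda>A. blinfun_apply A x"] by (simp add: blinfun.bilinear_simps)
  have ss: "s (s x) = K x" for x
    using s(2) by auto
  have "s (r x) = r (s x)" for x
    by (rule rc[rule_format]) (simp add: blinfun.bilinear_simps flip: ss)
  then have "norm s \<le> sqrt ?M"
    using r(1) s(1) by (intro norm_le_if_sum_squares[of r s ?M] positive_op_selfadj)
      (auto simp: rr ss)
  then have "norm s * norm s \<le> sqrt ?M * sqrt ?M" by (intro mult_mono) auto
  then show ?thesis using norm_blinfun_compose[of s s] by (simp add: s(2))
qed

section \<open>Positivity of the product of an operator and its adjoint\<close>

lemma positive_op_antisym: "positive_op ip K \<Longrightarrow> positive_op ip (- K) \<Longrightarrow> K = 0"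
  using positive_op_norm_mono[of K 0] by simp

text \<open>\<open>2 (D* D + D D*) = (D + D*)\<^sup>2 + (\<i> (D - D*))\<^sup>2\<close>.\<close>

lemma positive_op_adjoint_sum:
  fixes D E :: "'x \<Rightarrow>\<^sub>L 'x"
  assumes adj: "is_adjoint ip ip (blinfun_apply D) (blinfun_apply E)"
  shows "positive_op ip ((E o\<^sub>L D) + (D o\<^sub>L E))"
proof -
  have DE: "ip (D x) y = ip x (E y)" for x y using adj by (simp add: is_adjoint_def)
  have ED: "ip (E x) y = ip x (D y)" for x y using DE star_ip by metis
  have cD: "D (c *\<^sub>C x) = c *\<^sub>C D x" for c x
    by (rule ip_ext) (simp add: ED[symmetric] ip_scaleC_right)
  have cE: "E (c *\<^sub>C x) = c *\<^sub>C E x" for c x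
    by (rule ip_ext) (simp add: DE[symmetric] ip_scaleC_right)
  define H where "H = D + E"
  \<comment> \<open>\<open>D - E\<close> is skew-adjoint, and the factor \<open>\<i>\<close> makes
    it self-adjoint.\<close>
  define G where "G = Blinfun (\<lambda>x. \<i> *\<^sub>C (D x - E x))"
  have G: "G x = \<i> *\<^sub>C (D x - E x)" for x
  proof -
    have "bounded_linear (\<lambda>x. \<i> *\<^sub>C ((D - E) x))"
      by (rule bounded_linear_compose[OF bounded_linear_scaleC blinfun.bounded_linear_right])
    then show ?thesis by (simp add: G_def blinfun.bilinear_simps bounded_linear_Blinfun_apply)
  qed
  have "selfadj ip H"
    by (rule selfadjI) (simp add: H_def blinfun.bilinear_simps ip_add_left ip_add_right DE ED add.commute)
  moreover have "selfadj ip G"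
    by (rule selfadjI)
      (simp add: G ip_scaleC_left ip_scaleC_right ip_diff_left ip_diff_right DE ED scaleC_minus_left
        scaleC_diff_right)
  ultimately have "positive_op ip ((1/2) *\<^sub>R ((H o\<^sub>L H) + (G o\<^sub>L G)))"
    by (intro positive_op_scaleR positive_op_add positive_op_square) auto
  moreover have "(1/2) *\<^sub>R ((H o\<^sub>L H) + (G o\<^sub>L G)) = (E o\<^sub>L D) + (D o\<^sub>L E)"
  proof (rule blinfun_eqI)
    fix x
    have "H (H x) + G (G x) = 2 *\<^sub>R (E (D x) + D (E x))"
      by (simp add: H_def G blinfun.bilinear_simps cD cE scaleC_scaleC scaleC_diff_right
          scaleC_minus_one scaleR_2)
    then show "((1/2) *\<^sub>R ((H o\<^sub>L H) + (G o\<^sub>L G))) x = ((E o\<^sub>L D) + (D o\<^sub>L E)) x"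
      by (simp add: blinfun.bilinear_simps flip: scaleR_add_right)
  qed
  ultimately show ?thesis by simp
qed

text \<open>Write \<open>- D* D = S\<^sup>2\<close> and \<open>V = D S\<close>. Then \<open>V* V = - (D* D)\<^sup>2\<close> and \<open>V V* = - (D D*)\<^sup>2\<close>,
  whereas \<open>V* V + V V*\<close> is positive for every \<open>V\<close>.\<close>

lemma adjoint_compose_eq_0_if_negative:
  fixes D E :: "'x \<Rightarrow>\<^sub>L 'x"
  assumes adj: "is_adjoint ip ip (blinfun_apply D) (blinfun_apply E)"
    and neg: "positive_op ip (- (E o\<^sub>L D))"
  shows "E o\<^sub>L D = 0"
proof -
  have DE: "ip (D x) y = ip x (E y)" for x y using adj by (simp add: is_adjoint_def)
  have ED: "ip (E x) y = ip x (D y)" for x y using DE star_ip by metis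
  obtain S where S: "positive_op ip S" "S o\<^sub>L S = - (E o\<^sub>L D)"
    using positive_op_sqrt[OF neg] by metis
  have sS: "selfadj ip S" using S(1) by (rule positive_op_selfadj)
  have SS: "S (S x) = - E (D x)" for x
    using arg_cong[OF S(2), of "\<lambda>A. blinfun_apply A x"] by (simp add: blinfun.bilinear_simps)
  have ES: "E (D (S x)) = S (E (D x))" for x
    using SS[of "S x"] SS[of x] by (simp add: blinfun.bilinear_simps)
  let ?P = "(E o\<^sub>L D) o\<^sub>L (E o\<^sub>L D)" and ?Q = "(D o\<^sub>L E) o\<^sub>L (D o\<^sub>L E)"
  have sP: "selfadj ip (E o\<^sub>L D)" and sQ: "selfadj ip (D o\<^sub>L E)"
    by (auto intro!: selfadjI simp: DE ED)
  have "is_adjoint ip ip (blinfun_apply (D o\<^sub>L S)) (blinfun_apply (S o\<^sub>L E))"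
    by (simp add: is_adjoint_def DE selfadj_ip[OF sS])
  from positive_op_adjoint_sum[OF this]
  have "positive_op ip (((S o\<^sub>L E) o\<^sub>L (D o\<^sub>L S)) + ((D o\<^sub>L S) o\<^sub>L (S o\<^sub>L E)))" .
  also have "((S o\<^sub>L E) o\<^sub>L (D o\<^sub>L S)) + ((D o\<^sub>L S) o\<^sub>L (S o\<^sub>L E)) = - (?P + ?Q)"
    by (rule blinfun_eqI) (simp add: blinfun.bilinear_simps ES SS)
  finally have 1: "positive_op ip (- (?P + ?Q))" .
  have 2: "positive_op ip ?P" "positive_op ip ?Q"
    by (intro positive_op_square sP sQ)+
  \<comment> \<open>Adding \<open>?Q\<close> to the negative of the sum shows that
    \<open>- ?P\<close> is positive too, so antisymmetry applies.\<close>
  have "?P = 0"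
    using positive_op_antisym[OF 2(1)] positive_op_add[OF 1 2(2)] by simp
  then have "blinfun_apply ?P x = 0" for x by simp
  with sP show ?thesis by (intro selfadj_square_eq_0) auto
qed

text \<open>With \<open>P = \<bar>Q\<bar>\<close> and \<open>N = \<bar>Q\<bar> - Q\<close>, the compression of \<open>Q\<close> to its negative part is
  \<open>N Q N = - P N\<^sup>2 = - (\<surd>P N)\<^sup>2\<close>; if it vanishes then so does \<open>N\<^sup>2 = 2 P N\<close>.\<close>

lemma positive_op_if_negative_part_0:
  fixes Q :: "'x \<Rightarrow>\<^sub>L 'x"
  assumes Q: "selfadj ip Q"
    and neg: "\<And>N G :: 'x \<Rightarrow>\<^sub>L 'x. \<lbrakk>selfadj ip N; selfadj ip G; \<And>x. N (Q (N x)) = - G (G x)\<rbrakk> \<Longrightarrow> G = 0"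
  shows "positive_op ip Q"
proof -
  obtain P where P: "positive_op ip P" "P o\<^sub>L P = (Q o\<^sub>L Q)"
    and Pc: "\<forall>W :: 'x \<Rightarrow>\<^sub>L 'x. (\<forall>x. W ((Q o\<^sub>L Q) x) = (Q o\<^sub>L Q) (W x)) \<longrightarrow> (\<forall>x. W (P x) = P (W x))"
    using positive_op_sqrt[OF positive_op_square[OF Q]] by metis
  obtain S where S: "positive_op ip S" "S o\<^sub>L S = P"
    and Sc: "\<forall>W :: 'x \<Rightarrow>\<^sub>L 'x. (\<forall>x. W (P x) = P (W x)) \<longrightarrow> (\<forall>x. W (S x) = S (W x))"
    using positive_op_sqrt[OF P(1)] by metis
  \<comment> \<open>\<open>Q\<close> commutes with its square, hence with the root \<open>P\<close>,
    hence with the root \<open>S\<close> of \<open>P\<close>.\<close>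
  have QP: "Q (P x) = P (Q x)" for x by (rule Pc[rule_format]) simp
  have QS: "Q (S x) = S (Q x)" for x by (rule Sc[rule_format]) (rule QP)
  have PS: "P (S x) = S (P x)" for x by (rule Sc[rule_format]) simp
  have PP: "P (P x) = Q (Q x)" for x
    using arg_cong[OF P(2), of "\<lambda>A. blinfun_apply A x"] by simp
  have SS: "S (S x) = P x" for x
    using arg_cong[OF S(2), of "\<lambda>A. blinfun_apply A x"] by simp
  define N where "N = P - Q"
  have N: "N x = P x - Q x" for x by (simp add: N_def blinfun.bilinear_simps)
  have sN: "selfadj ip N" unfolding N_def by (intro selfadj_diff positive_op_selfadj P Q)
  have SN: "S (N x) = N (S x)" for x by (simp add: N blinfun.bilinear_simps PS QS)
  have "selfadj ip (S o\<^sub>L N)" by (intro selfadj_compose sN positive_op_selfadj S SN)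
  moreover have "N (Q (N x)) = - ((S o\<^sub>L N) ((S o\<^sub>L N) x))" for x
  proof -
    \<comment> \<open>As \<open>P\<close> and \<open>Q\<close> commute and have equal squares,
      \<open>Q (P - Q) = P Q - P\<^sup>2 = - P (P - Q)\<close>.\<close>
    have "Q (N x) = - P (N x)" by (simp add: N blinfun.bilinear_simps QP PP)
    moreover have "P (N x) = N (P x)" by (simp add: N blinfun.bilinear_simps QP)
    ultimately show ?thesis by (simp add: blinfun.bilinear_simps SN SS)
  qed
  ultimately have "S o\<^sub>L N = 0" using neg sN by blast
  then have SN0: "S (N x) = 0" for x by (metis blinfun_apply_blinfun_compose zero_blinfun.rep_eq)
  have "N (N x) = 0" for x
  proof -
    have "N (N x) = P (N x) + P (N x)" by (simp add: N blinfun.bilinear_simps QP PP)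
    also have "\<dots> = 0" by (simp add: SN0 blinfun.bilinear_simps flip: SS)
    finally show ?thesis .
  qed
  then have "N = 0" by (rule selfadj_square_eq_0[OF sN])
  with P(1) show ?thesis by (simp add: N_def)
qed

text \<open>Compressing \<open>E D\<close> by a self-adjoint \<open>N\<close> gives the adjoint of
  \<open>D N\<close> times \<open>D N\<close>. If this is minus a square, it vanishes by
  \<open>adjoint_compose_eq_0_if_negative\<close>.\<close>

lemma positive_op_adjoint_compose:
  fixes D E :: "'x \<Rightarrow>\<^sub>L 'x"
  assumes adj: "is_adjoint ip ip (blinfun_apply D) (blinfun_apply E)"
  shows "positive_op ip (E o\<^sub>L D)"
proof (rule positive_op_if_negative_part_0)
  have DE: "ip (D x) y = ip x (E y)" for x y using adj by (simp add: is_adjoint_def)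
  have ED: "ip (E x) y = ip x (D y)" for x y using DE star_ip by metis
  show "selfadj ip (E o\<^sub>L D)" by (auto intro!: selfadjI simp: DE ED)
  fix N G :: "'x \<Rightarrow>\<^sub>L 'x"
  assume N: "selfadj ip N" and G: "selfadj ip G" and NG: "\<And>x. N ((E o\<^sub>L D) (N x)) = - G (G x)"
  have eq: "- ((N o\<^sub>L E) o\<^sub>L (D o\<^sub>L N)) = (G o\<^sub>L G)"
    by (rule blinfun_eqI) (use NG in \<open>simp add: blinfun.bilinear_simps\<close>)
  have "is_adjoint ip ip (blinfun_apply (D o\<^sub>L N)) (blinfun_apply (N o\<^sub>L E))"
    by (simp add: is_adjoint_def DE selfadj_ip[OF N])
  moreover have "positive_op ip (- ((N o\<^sub>L E) o\<^sub>L (D o\<^sub>L N)))"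
    unfolding eq by (rule positive_op_square[OF G])
  ultimately have "(N o\<^sub>L E) o\<^sub>L (D o\<^sub>L N) = 0" by (rule adjoint_compose_eq_0_if_negative)
  then have "G (G x) = 0" for x
    using NG[of x] by (metis blinfun_apply_blinfun_compose zero_blinfun.rep_eq neg_equal_0_iff_equal)
  then show "G = 0" by (rule selfadj_square_eq_0[OF G])
qed

end

subsection \<open>Positive elements and the Cauchy--Schwarz inequality\<close>

text \<open>Viewing the algebra as a module over itself makes the operator results available for its
  elements.\<close>

lemma hilbert_module_algebra: "hilbert_module ((*) :: 'a::cstar_algebra \<Rightarrow> 'a \<Rightarrow> 'a) algebra_ip"
proof
  show "0 \<preceq> algebra_ip x x" for x :: 'a
    unfolding cstar_le_def algebra_ip_def by (rule exI[of _ x]) simp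
qed (simp_all add: algebra_ip_def distrib_left distrib_right mult.assoc mult_scaleC_left
    mult_scaleC_right star_mult star_star cstar_identity)

interpretation algebra: hilbert_module "(*) :: 'a::cstar_algebra \<Rightarrow> 'a \<Rightarrow> 'a" algebra_ip
  by (rule hilbert_module_algebra)

text \<open>\<open>blinfun_mult_right a\<close> is \<open>x \<mapsto> a * x\<close>. Unlike the form
  \<open>star c * c\<close> in \<open>\<preceq>\<close>, this notion inherits closure under sums and
  limits directly from operators.\<close>

definition positive_elem :: "'a::cstar_algebra \<Rightarrow> bool" where
  "positive_elem a \<longleftrightarrow> positive_op algebra_ip (blinfun_mult_right a)"

text \<open>The lower bound comes from testing the operator on \<open>star a\<close> and using the
  C*-identity.\<close>

lemma norm_blinfun_mult_right: "norm (blinfun_mult_right a) = norm (a :: 'a::cstar_algebra)"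
proof (rule antisym)
  show "norm (blinfun_mult_right a) \<le> norm a"
    by (rule norm_blinfun_bound) (simp_all add: blinfun_mult_right.rep_eq norm_mult_ineq)
  have "norm a * norm a = norm (a * star a)"
    using cstar_identity[of "star a"] by (simp add: star_star norm_star power2_eq_square)
  also have "\<dots> \<le> norm (blinfun_mult_right a) * norm a"
    using norm_blinfun[of "blinfun_mult_right a" "star a"]
    by (simp add: blinfun_mult_right.rep_eq norm_star)
  finally show "norm a \<le> norm (blinfun_mult_right a)"
    by (cases "a = 0") auto
qed

lemmas blinfun_mult_right_linear = bounded_linear.linear[OF bounded_linear_blinfun_mult_right]
lemmas blinfun_mult_right_add = linear_add[OF blinfun_mult_right_linear]
  and blinfun_mult_right_diff = linear_diff[OF blinfun_mult_right_linear]
  and blinfun_mult_right_scaleR = linear_scale[OF blinfun_mult_right_linear]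
  and blinfun_mult_right_zero = linear_0[OF blinfun_mult_right_linear]

lemma positive_elem_zero: "positive_elem 0"
  by (simp add: positive_elem_def blinfun_mult_right_zero algebra.positive_op_zero)

lemma positive_elem_add: "positive_elem a \<Longrightarrow> positive_elem b \<Longrightarrow> positive_elem (a + b)"
  by (simp add: positive_elem_def blinfun_mult_right_add algebra.positive_op_add)

lemma positive_elem_sum: "(\<And>i. i \<in> I \<Longrightarrow> positive_elem (f i)) \<Longrightarrow> positive_elem (sum f I)"
  by (induction I rule: infinite_finite_induct) (auto simp: positive_elem_zero positive_elem_add)

lemma positive_elem_scaleR: "positive_elem a \<Longrightarrow> r \<ge> 0 \<Longrightarrow> positive_elem (r *\<^sub>R a)"
  by (simp add: positive_elem_def blinfun_mult_right_scaleR algebra.positive_op_scaleR)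

lemma positive_elem_limit:
  assumes "\<And>n. positive_elem (f n)" "f \<longlonglongrightarrow> a"
  shows "positive_elem a"
  using assms(1) bounded_linear.tendsto[OF bounded_linear_blinfun_mult_right assms(2)]
  unfolding positive_elem_def by (rule algebra.positive_op_limit)

lemma positive_elem_suminf:
  assumes "\<And>n. positive_elem (f n)" "summable f"
  shows "positive_elem (suminf f)"
  by (rule positive_elem_limit[OF _ summable_LIMSEQ[OF assms(2)]]) (simp add: positive_elem_sum assms)

lemma positive_elem_norm_mono:
  "positive_elem a \<Longrightarrow> positive_elem (b - a) \<Longrightarrow> norm a \<le> norm b"
  using algebra.positive_op_norm_mono[of "blinfun_mult_right a" "blinfun_mult_right b"]
  by (simp add: positive_elem_def blinfun_mult_right_diff norm_blinfun_mult_right)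

lemma positive_elem_star_mult: "positive_elem (star c * c)"
proof -
  have "is_adjoint algebra_ip algebra_ip (blinfun_mult_right c) (blinfun_mult_right (star c))"
    by (simp add: is_adjoint_def algebra_ip_def blinfun_mult_right.rep_eq star_mult mult.assoc)
  then have "positive_op algebra_ip (blinfun_mult_right (star c) o\<^sub>L blinfun_mult_right c)"
    by (rule algebra.positive_op_adjoint_compose)
  moreover have "(blinfun_mult_right (star c) o\<^sub>L blinfun_mult_right c) = blinfun_mult_right (star c * c)"
    by (rule blinfun_eqI) (simp add: blinfun_mult_right.rep_eq mult.assoc)
  ultimately show ?thesis by (simp add: positive_elem_def)
qed

lemma cstar_le_imp_positive_elem: "a \<preceq> b \<Longrightarrow> positive_elem (b - a)"
  by (auto simp: cstar_le_def positive_elem_star_mult)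

lemma (in hilbert_module) positive_elem_ip: "positive_elem (ip x x)"
  using cstar_le_imp_positive_elem[OF ip_self_pos] by simp

text \<open>The way back from positive operators to the explicit squares demanded by
  \<open>\<preceq>\<close>: \<open>y\<close> is the image of \<open>x\<close> under the root of
  \<open>K\<close>.\<close>

lemma (in hilbert_module) ip_positive_op:
  assumes "positive_op ip K"
  obtains y where "ip x (K x) = ip y y"
proof -
  obtain S where S: "positive_op ip S" "S o\<^sub>L S = K" using positive_op_sqrt[OF assms] by metis
  have "ip x (K x) = ip x (S (S x))" unfolding S(2)[symmetric] by simp
  also have "\<dots> = ip (S x) (S x)"
    by (simp only: selfadj_ip[OF positive_op_selfadj[OF S(1)]])
  finally have "ip x (K x) = ip (S x) (S x)" .
  then show thesis by (rule that)
qed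

section \<open>Cauchy-Schwarz inequalities\<close>

text \<open>Here \<open>p\<close>, \<open>a\<close>, \<open>q\<close> stand for the inner products
  of \<open>f\<close> with \<open>f\<close>, \<open>f\<close> with \<open>g\<close> and
  \<open>g\<close> with \<open>g\<close>, and the hypothesis is positivity of the inner square of
  \<open>f b - g\<close>. Inserting \<open>b = t *\<^sub>R a\<close> and estimating \<open>p\<close>
  by its norm leaves a scalar inequality in \<open>t\<close>.\<close>

lemma cauchy_schwarz_positive_elem:
  fixes p q a :: "'a::cstar_algebra"
  assumes p: "positive_elem p"
    and pos: "\<And>b. positive_elem (star b * p * b - star b * a - star a * b + q)"
  shows "(norm a)\<^sup>2 \<le> norm p * norm q"
proof -
  have *: "(2 * t - t\<^sup>2 * norm p) * (norm a)\<^sup>2 \<le> norm q" for t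
  proof (cases "2 * t - t\<^sup>2 * norm p \<ge> 0")
    case True
    let ?L = "blinfun_mult_right p"
    have "selfadj algebra_ip ?L"
      using p by (simp add: positive_elem_def algebra.positive_op_selfadj)
    \<comment> \<open>Positivity of \<open>norm p - p\<close> bounds \<open>star a * p * a\<close>
      by \<open>norm p\<close> times \<open>star a * a\<close>.\<close>
    then have "positive_op algebra_ip (norm p *\<^sub>R id_blinfun - ?L)"
      unfolding positive_op_def
      by (intro conjI exI[of _ "norm p"] algebra.selfadj_diff algebra.selfadj_scaleR algebra.selfadj_id)
        (simp_all add: norm_blinfun_mult_right)
    then obtain y where "algebra_ip a ((norm p *\<^sub>R id_blinfun - ?L) a) = algebra_ip y y"
      by (rule algebra.ip_positive_op)
    then have "positive_elem (star a * (norm p *\<^sub>R a - p * a))"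
      using positive_elem_star_mult[of y]
      by (simp add: algebra_ip_def blinfun.bilinear_simps blinfun_mult_right.rep_eq)
    moreover define z w where "z = star a * a" and "w = star a * (p * a)"
    ultimately have "positive_elem (norm p *\<^sub>R z - w)"
      by (simp add: right_diff_distrib)
    then have "positive_elem (t\<^sup>2 *\<^sub>R (norm p *\<^sub>R z - w))"
      by (rule positive_elem_scaleR) simp
    moreover have "star (t *\<^sub>R a) * p * (t *\<^sub>R a) - star (t *\<^sub>R a) * a - star a * (t *\<^sub>R a) + q =
        t\<^sup>2 *\<^sub>R w - (t + t) *\<^sub>R z + q"
      unfolding scaleR_add_left by (simp add: z_def w_def star_scaleR mult.assoc power2_eq_square)
    with pos[of "t *\<^sub>R a"] have "positive_elem (t\<^sup>2 *\<^sub>R w - (t + t) *\<^sub>R z + q)"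
      by (simp only:)
    ultimately have "positive_elem (t\<^sup>2 *\<^sub>R (norm p *\<^sub>R z - w) + (t\<^sup>2 *\<^sub>R w - (t + t) *\<^sub>R z + q))"
      by (rule positive_elem_add)
    also have "t\<^sup>2 *\<^sub>R (norm p *\<^sub>R z - w) + (t\<^sup>2 *\<^sub>R w - (t + t) *\<^sub>R z + q) =
        q - (t + t - t\<^sup>2 * norm p) *\<^sub>R z"
      unfolding scaleR_diff_right scaleR_diff_left scaleR_scaleR by simp
    finally have "positive_elem (q - (2 * t - t\<^sup>2 * norm p) *\<^sub>R (star a * a))"
      by (simp add: z_def)
    from positive_elem_norm_mono[OF positive_elem_scaleR[OF positive_elem_star_mult True] this]
    show ?thesis using True by (simp add: cstar_identity)
  next
    case False
    then have "(2 * t - t\<^sup>2 * norm p) * (norm a)\<^sup>2 \<le> 0"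
      by (intro mult_nonpos_nonneg) auto
    then show ?thesis by (rule order_trans) simp
  qed
  show ?thesis
  proof (cases "p = 0")
    case True
    \<comment> \<open>For \<open>p = 0\<close> the left side of \<open>*\<close> grows linearly in
      \<open>t\<close>; the chosen \<open>t\<close> makes it
      \<open>2 * (norm q + 1)\<close>.\<close>
    have "a = 0"
    proof (rule ccontr)
      assume "a \<noteq> 0"
      with *[of "(norm q + 1) / (norm a)\<^sup>2"] True have "norm q + 2 \<le> 0" by simp
      moreover have "0 < norm q + 2" by (rule add_nonneg_pos) simp_all
      ultimately show False by simp
    qed
    then show ?thesis by simp
  next
    case False
    \<comment> \<open>This \<open>t\<close> maximises \<open>2 * t - t\<^sup>2 * norm p\<close>,
      with value \<open>1 / norm p\<close>.\<close>
    with *[of "1 / norm p"] show ?thesis by (simp add: power2_eq_square field_simps)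
  qed
qed

lemma (in hilbert_module) cauchy_schwarz: "norm (ip x y) \<le> norm x * norm y"
proof -
  have "(norm (ip x y))\<^sup>2 \<le> norm (ip x x) * norm (ip y y)"
  proof (rule cauchy_schwarz_positive_elem[OF positive_elem_ip])
    fix b
    have "ip (act x b - y) (act x b - y) = star b * ip x x * b - star b * ip x y - star (ip x y) * b + ip y y"
      by (simp add: ip_diff_left ip_diff_right ip_act_left ip_act_right star_ip algebra_simps)
    with positive_elem_ip[of "act x b - y"]
    show "positive_elem (star b * ip x x * b - star b * ip x y - star (ip x y) * b + ip y y)"
      by simp
  qed
  then have "(norm (ip x y))\<^sup>2 \<le> (norm x * norm y)\<^sup>2"
    by (simp add: norm_power2[symmetric] power_mult_distrib)
  then show ?thesis by (simp add: power2_le_iff_abs_le)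
qed

text \<open>\<open>ell2\<close> carries no norm or module structure here, so its estimates go
  through finite sums.\<close>

lemma cauchy_schwarz_sum:
  fixes f g :: "'i \<Rightarrow> 'a::cstar_algebra"
  shows "(norm (\<Sum>i\<in>I. star (f i) * g i))\<^sup>2 \<le>
    norm (\<Sum>i\<in>I. star (f i) * f i) * norm (\<Sum>i\<in>I. star (g i) * g i)"
proof (rule cauchy_schwarz_positive_elem)
  show "positive_elem (\<Sum>i\<in>I. star (f i) * f i)"
    by (intro positive_elem_sum positive_elem_star_mult)
  fix b
  have "positive_elem (\<Sum>i\<in>I. star (f i * b - g i) * (f i * b - g i))"
    by (intro positive_elem_sum positive_elem_star_mult)
  also have "(\<Sum>i\<in>I. star (f i * b - g i) * (f i * b - g i)) =
    star b * (\<Sum>i\<in>I. star (f i) * f i) * b - star b * (\<Sum>i\<in>I. star (f i) * g i)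
      - star (\<Sum>i\<in>I. star (f i) * g i) * b + (\<Sum>i\<in>I. star (g i) * g i)"
    by (simp add: star_sum star_mult star_diff star_star algebra_simps sum_distrib_left
        sum_distrib_right sum.distrib sum_subtractf)
  finally show "positive_elem \<dots>" .
qed

text \<open>Cauchy-Schwarz bounds each block of the mixed series by the blocks of the two given
  ones, so the Cauchy criterion carries over.\<close>

lemma summable_star_mult:
  fixes f g :: "nat \<Rightarrow> 'a::cstar_algebra"
  assumes "summable (\<lambda>n. star (f n) * f n)" "summable (\<lambda>n. star (g n) * g n)"
  shows "summable (\<lambda>n. star (f n) * g n)"
  unfolding summable_Cauchy
proof (intro allI impI)
  fix e :: real assume e: "e > 0"
  obtain M where M: "\<forall>m\<ge>M. \<forall>n. norm (\<Sum>i=m..<n. star (f i) * f i) < e"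
    using assms(1) e unfolding summable_Cauchy by blast
  obtain N where N: "\<forall>m\<ge>N. \<forall>n. norm (\<Sum>i=m..<n. star (g i) * g i) < e"
    using assms(2) e unfolding summable_Cauchy by blast
  have "norm (\<Sum>i=m..<n. star (f i) * g i) < e" if "m \<ge> max M N" for m n
  proof -
    have "norm (\<Sum>i=m..<n. star (f i) * f i) < e" "norm (\<Sum>i=m..<n. star (g i) * g i) < e"
      using M N that by auto
    then have "norm (\<Sum>i=m..<n. star (f i) * f i) * norm (\<Sum>i=m..<n. star (g i) * g i) < e * e"
      using e by (intro mult_strict_mono) auto
    then have "(norm (\<Sum>i=m..<n. star (f i) * g i))\<^sup>2 < e\<^sup>2"
      unfolding power2_eq_square[of e] by (rule le_less_trans[OF cauchy_schwarz_sum])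
    then show ?thesis by (rule power2_less_imp_less) (use e in simp)
  qed
  then show "\<exists>N. \<forall>m\<ge>N. \<forall>n. norm (\<Sum>i=m..<n. star (f i) * g i) < e" by blast
qed

lemma summable_Rep_ell2: "summable (\<lambda>n. star (Rep_ell2 f n) * Rep_ell2 g n)"
proof -
  have *: "summable (\<lambda>n. star (Rep_ell2 f n) * Rep_ell2 f n)" for f :: "'a ell2"
    using Rep_ell2[of f] unfolding mem_Collect_eq .
  show ?thesis by (rule summable_star_mult[OF * *])
qed

lemma star_ell2_ip: "star (ell2_ip f g) = ell2_ip g f"
  unfolding ell2_ip_def
  by (subst bounded_linear.suminf[OF bounded_linear_star summable_Rep_ell2])
    (simp add: star_mult star_star)

lemma positive_elem_ell2_ip: "positive_elem (ell2_ip f f)"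
  unfolding ell2_ip_def by (intro positive_elem_suminf positive_elem_star_mult summable_Rep_ell2)

lemma cauchy_schwarz_ell2: "(norm (ell2_ip f g))\<^sup>2 \<le> norm (ell2_ip f f) * norm (ell2_ip g g)"
proof (rule LIMSEQ_le)
  show "(\<lambda>n. (norm (\<Sum>i<n. star (Rep_ell2 f i) * Rep_ell2 g i))\<^sup>2) \<longlonglongrightarrow> (norm (ell2_ip f g))\<^sup>2"
    unfolding ell2_ip_def by (intro tendsto_intros summable_LIMSEQ summable_Rep_ell2)
  show "(\<lambda>n. norm (\<Sum>i<n. star (Rep_ell2 f i) * Rep_ell2 f i) *
      norm (\<Sum>i<n. star (Rep_ell2 g i) * Rep_ell2 g i)) \<longlonglongrightarrow> norm (ell2_ip f f) * norm (ell2_ip g g)"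
    unfolding ell2_ip_def by (intro tendsto_intros summable_LIMSEQ summable_Rep_ell2)
qed (auto intro: cauchy_schwarz_sum)

text \<open>The terms outside \<open>I\<close> are positive and so is their sum; the norm is
  monotone on positive elements.\<close>

lemma norm_sum_le_suminf:
  assumes "summable (\<lambda>n. star (f n) * f n)" "finite I"
  shows "norm (\<Sum>i\<in>I. star (f i) * f i) \<le> norm (\<Sum>n. star (f n) * f n :: 'a::cstar_algebra)"
proof (rule positive_elem_norm_mono)
  show "positive_elem (\<Sum>i\<in>I. star (f i) * f i)"
    by (intro positive_elem_sum positive_elem_star_mult)
  have "summable (\<lambda>n. if n \<in> I then 0 else star (f n) * f n)"
    "(\<Sum>n. star (f n) * f n) - (\<Sum>i\<in>I. star (f i) * f i) = (\<Sum>n. if n \<in> I then 0 else star (f n) * f n)"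
  proof -
    have "(\<lambda>n. star (f n) * f n - (if n \<in> I then star (f n) * f n else 0)) sums
      ((\<Sum>n. star (f n) * f n) - (\<Sum>i\<in>I. star (f i) * f i))"
      by (intro sums_diff summable_sums assms sums_If_finite_set)
    moreover have "star (f n) * f n - (if n \<in> I then star (f n) * f n else 0) =
      (if n \<in> I then 0 else star (f n) * f n)" for n
      by simp
    ultimately have "(\<lambda>n. if n \<in> I then 0 else star (f n) * f n) sums
      ((\<Sum>n. star (f n) * f n) - (\<Sum>i\<in>I. star (f i) * f i))"
      by simp
    then show "summable (\<lambda>n. if n \<in> I then 0 else star (f n) * f n)"
      "(\<Sum>n. star (f n) * f n) - (\<Sum>i\<in>I. star (f i) * f i) = (\<Sum>n. if n \<in> I then 0 else star (f n) * f n)"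
      by (simp_all add: sums_iff)
  qed
  then show "positive_elem ((\<Sum>n. star (f n) * f n) - (\<Sum>i\<in>I. star (f i) * f i))"
    by (auto intro!: positive_elem_suminf simp: positive_elem_zero positive_elem_star_mult)
qed

subsection \<open>Frames from surjections\<close>

text \<open>Banach-Steinhaus by Baire category: the closed sets \<open>E n\<close> cover the space,
  so one of them contains a ball.\<close>

lemma uniform_boundedness:
  fixes F :: "('x::banach \<Rightarrow>\<^sub>L 'b::real_normed_vector) set"
  assumes bdd: "\<And>x. \<exists>C. \<forall>f\<in>F. norm (blinfun_apply f x) \<le> C"
  obtains k where "\<And>f. f \<in> F \<Longrightarrow> norm f \<le> k"
proof -
  define E where "E n = {x. \<forall>f\<in>F. norm (blinfun_apply f x) \<le> real n}" for n
  have cl: "closed (E n)" for n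
  proof -
    have "E n = (\<Inter>f\<in>F. {x. norm (blinfun_apply f x) \<le> real n})" by (auto simp: E_def)
    moreover have "closed {x. norm (blinfun_apply f x) \<le> real n}" for f :: "'x \<Rightarrow>\<^sub>L 'b"
      by (intro closed_Collect_le continuous_intros)
    ultimately show ?thesis by (simp add: closed_INT)
  qed
  have "\<exists>n. interior (E n) \<noteq> {}"
  proof (rule ccontr)
    assume *: "\<nexists>n. interior (E n) \<noteq> {}"
    have "Met_TC.mtopology interior_of (\<Union>(range E)) = {}"
      by (rule Met_TC.metric_Baire_category_alt)
        (use cl * in \<open>auto simp: interior_of_def interior_def complete_UNIV\<close>)
    moreover have "\<Union>(range E) = UNIV"
    proof -
      have "\<exists>n. x \<in> E n" for x
      proof -
        obtain C where "\<forall>f\<in>F. norm (blinfun_apply f x) \<le> C" using bdd by blast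
        moreover obtain n :: nat where "C \<le> real n" using real_arch_simple by blast
        ultimately have "x \<in> E n" by (auto simp: E_def intro: order_trans)
        then show ?thesis ..
      qed
      then show ?thesis by blast
    qed
    ultimately have "euclidean interior_of (UNIV :: 'x set) = {}" by simp
    then show False using interior_of_topspace[of "euclidean :: 'x topology"] by simp
  qed
  then obtain n x where "x \<in> interior (E n)" by blast
  then obtain e where e: "e > 0" "cball x e \<subseteq> E n"
    by (metis mem_interior_cball)
  have "norm f \<le> 2 * real n / e" if f: "f \<in> F" for f
  proof (rule norm_blinfun_bound)
    fix z
    show "norm (f z) \<le> 2 * real n / e * norm z"
    proof (cases "z = 0")
      case False
      \<comment> \<open>Rescaled to length \<open>e\<close>, the vector stays in the ball around
        \<open>x\<close>, and \<open>f w\<close> is a difference of two values bounded by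
        \<open>n\<close>.\<close>
      define w where "w = (e / norm z) *\<^sub>R z"
      have "norm w = e" using False e by (simp add: w_def)
      then have "x + w \<in> E n" "x \<in> E n" using e by (auto simp: dist_norm)
      then have "norm (f (x + w)) \<le> n" "norm (f x) \<le> n" using f by (auto simp: E_def)
      then have "norm (f (x + w) - f x) \<le> 2 * n"
        using norm_triangle_ineq4[of "f (x + w)" "f x"] by linarith
      moreover have "f (x + w) - f x = f w" by (simp add: blinfun.bilinear_simps)
      ultimately have "norm (f w) \<le> 2 * n" by simp
      then have "e / norm z * norm (f z) \<le> 2 * n"
        using e by (simp add: w_def blinfun.bilinear_simps)
      then show ?thesis using False e by (simp add: field_simps)
    qed simp
  qed (use e in auto)
  then show thesis by (rule that)
qed

lemma mult_ip_eqI: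
  assumes "is_adjoint algebra_ip ip v V"
  shows "v \<in> multiplier_module ip" "mult_ip ip v = V"
proof -
  show v: "v \<in> multiplier_module ip"
    using assms by (auto simp: multiplier_module_def adjointable_def)
  have "algebra_ip a (mult_ip ip v y) = algebra_ip a (V y)" for a y
    using is_adjoint_adjoint_op[OF v] assms unfolding is_adjoint_def mult_ip_def by metis
  then show "mult_ip ip v = V"
    by (rule ext[OF algebra_ip_cancel])
qed

text \<open>The sequence \<open>e\<^sub>n a\<close>. Without a unit there is no
  \<open>e\<^sub>n\<close> itself, so the entry is an argument.\<close>

definition ell2_single :: "nat \<Rightarrow> 'a::cstar_algebra \<Rightarrow> 'a ell2" where
  "ell2_single n a = Abs_ell2 (\<lambda>m. if m = n then a else 0)"

lemma Rep_ell2_single: "Rep_ell2 (ell2_single n a) = (\<lambda>m. if m = n then a else 0)"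
proof -
  have "summable (\<lambda>m. star (if m = n then a else 0) * (if m = n then a else 0))"
    by (rule summable_finite[of "{n}"]) auto
  then show ?thesis unfolding ell2_single_def by (intro Abs_ell2_inverse) simp
qed

lemma ell2_ip_single: "ell2_ip (ell2_single n a) f = star a * Rep_ell2 f n"
proof -
  have "(\<lambda>m. star (if m = n then a else 0) * Rep_ell2 f m) =
      (\<lambda>m. if m = n then star a * Rep_ell2 f m else 0)"
    by (auto simp: star_zero)
  then show ?thesis
    unfolding ell2_ip_def Rep_ell2_single
    using sums_unique[OF sums_single[of n "\<lambda>m. star a * Rep_ell2 f m"]] by simp
qed

section \<open>Automatic boundedness and lower bounds\<close>

context hilbert_module
begin

lemma bounded_linear_ip: "bounded_linear (ip x)"
  by (rule bounded_bilinear.bounded_linear_right[OF bounded_bilinear_ip])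

lemma norm_ip_commute: "norm (ip x y) = norm (ip y x)"
  by (metis star_ip norm_star)

lemma norm_le_if_ip_le:
  assumes "k \<ge> 0" "norm (ip x x) \<le> k * norm x"
  shows "norm x \<le> k"
  using assms by (cases "x = 0") (auto simp: norm_power2[symmetric] power2_eq_square)

lemma adjoint_op_eq:
  assumes "is_adjoint ip ipY U T"
  shows "adjoint_op ip ipY U = T"
  unfolding adjoint_op_def
proof (rule the_equality)
  fix T' assume T': "is_adjoint ip ipY U T'"
  have "ip x (T' f) = ip x (T f)" for x f
    using assms T' unfolding is_adjoint_def by metis
  then show "T' = T" by (rule ext[OF ip_ext])
qed (rule assms)

text \<open>The Hellinger-Toeplitz theorem: for \<open>norm x \<le> 1\<close> the functionals
  \<open>ip (f x)\<close> are bounded at each \<open>y\<close> by \<open>norm (f y)\<close>, hence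
  uniformly; evaluating at \<open>f x\<close> bounds \<open>f\<close>.\<close>

lemma bounded_linear_if_symmetric:
  assumes sym: "\<And>x y. ip (f x) y = ip x (f y)"
  shows "bounded_linear f"
proof -
  let ?G = "\<lambda>x. Blinfun (ip (f x))"
  have G: "blinfun_apply (?G x) y = ip (f x) y" for x y
    by (simp add: bounded_linear_Blinfun_apply bounded_linear_ip)
  have "\<exists>C. \<forall>g\<in>?G ` {x. norm x \<le> 1}. norm (blinfun_apply g y) \<le> C" for y
  proof (rule exI[of _ "norm (f y)"], clarify)
    fix x :: 'x assume x: "norm x \<le> 1"
    have "norm (ip (f x) y) \<le> norm x * norm (f y)" unfolding sym by (rule cauchy_schwarz)
    also have "\<dots> \<le> 1 * norm (f y)" by (rule mult_right_mono[OF x norm_ge_zero])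
    finally show "norm (blinfun_apply (?G x) y) \<le> norm (f y)" by (simp add: G)
  qed
  then obtain k where k: "\<And>g. g \<in> ?G ` {x. norm x \<le> 1} \<Longrightarrow> norm g \<le> k"
    using uniform_boundedness[of "?G ` {x. norm x \<le> 1}"] by blast
  have 1: "norm (f x) \<le> k" if x: "norm x \<le> 1" for x
  proof (rule norm_le_if_ip_le)
    have Gk: "norm (?G x) \<le> k" by (rule k) (use x in simp)
    then show "0 \<le> k" using norm_ge_zero order_trans by blast
    have "norm (ip (f x) (f x)) \<le> norm (?G x) * norm (f x)"
      using norm_blinfun[of "?G x" "f x"] by (simp only: G)
    also have "\<dots> \<le> k * norm (f x)" by (rule mult_right_mono[OF Gk norm_ge_zero])
    finally show "norm (ip (f x) (f x)) \<le> k * norm (f x)" .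
  qed
  have scale: "f (r *\<^sub>R x) = r *\<^sub>R f x" for r x
    by (rule ip_ext) (simp add: sym[symmetric] ip_scaleR_right)
  show ?thesis
  proof (rule bounded_linear_intro[where K = k])
    show "f (x + y) = f x + f y" for x y
      by (rule ip_ext) (simp add: sym[symmetric] ip_add_right)
    show "norm (f x) \<le> norm x * k" for x
    proof (cases "x = 0")
      case True
      then show ?thesis using scale[of 0 0] by simp
    next
      case False
      then have "norm (f ((1 / norm x) *\<^sub>R x)) \<le> k" by (intro 1) simp
      then show ?thesis using False by (simp add: scale field_simps)
    qed
  qed (rule scale)
qed

text \<open>For \<open>x = T f\<close>, Cauchy-Schwarz bounds \<open>ip y x\<close> by a constant
  times the length of \<open>S y\<close>. Surjectivity makes this a bound at every point for the
  functionals \<open>ip y\<close> divided by that length; the uniform bound, evaluated at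
  \<open>y\<close>, is the claim.\<close>

lemma adjoint_bounded_below:
  assumes adj: "is_adjoint ell2_ip ip T S" and "surj T"
  obtains k where "k > 0" "\<And>x. (norm x)\<^sup>2 \<le> k * norm (ell2_ip (S x) (S x))"
proof -
  define \<tau> where "\<tau> y = sqrt (norm (ell2_ip (S y) (S y)))" for y
  have \<tau>: "\<exists>C. \<forall>y. norm (ip y x) \<le> C * \<tau> y" for x
  proof -
    obtain f where f: "x = T f" using \<open>surj T\<close> by (metis surjD)
    have "norm (ip y x) \<le> sqrt (norm (ell2_ip f f)) * \<tau> y" for y
    proof -
      have "(norm (ip x y))\<^sup>2 \<le> norm (ell2_ip f f) * norm (ell2_ip (S y) (S y))"
        using adj cauchy_schwarz_ell2[of f "S y"] by (simp add: is_adjoint_def f)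
      then have "sqrt ((norm (ip x y))\<^sup>2) \<le> sqrt (norm (ell2_ip f f) * norm (ell2_ip (S y) (S y)))"
        by (rule real_sqrt_le_mono)
      then show ?thesis by (simp add: \<tau>_def real_sqrt_mult norm_ip_commute[of y])
    qed
    then show ?thesis by blast
  qed
  let ?G = "\<lambda>y. (1 / \<tau> y) *\<^sub>R Blinfun (ip y)"
  have G: "blinfun_apply (?G y) x = (1 / \<tau> y) *\<^sub>R ip y x" for x y
    by (simp add: bounded_linear_Blinfun_apply bounded_linear_ip blinfun.bilinear_simps)
  have "\<exists>C. \<forall>g\<in>?G ` {y. \<tau> y > 0}. norm (blinfun_apply g x) \<le> C" for x
  proof -
    obtain C where C: "\<And>y. norm (ip y x) \<le> C * \<tau> y" using \<tau> by blast
    have "norm (blinfun_apply (?G y) x) \<le> C" if "\<tau> y > 0" for y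
      using C[of y] that by (simp add: G field_simps)
    then show ?thesis by blast
  qed
  then obtain k where k: "\<And>g. g \<in> ?G ` {y. \<tau> y > 0} \<Longrightarrow> norm g \<le> k"
    using uniform_boundedness[of "?G ` {y. \<tau> y > 0}"] by blast
  \<comment> \<open>The uniform bound \<open>k\<close> has no prescribed sign;
    \<open>k\<^sup>2 + 1\<close> is positive in any case.\<close>
  have "(norm y)\<^sup>2 \<le> (k\<^sup>2 + 1) * norm (ell2_ip (S y) (S y))" for y
  proof (cases "\<tau> y > 0")
    case True
    then have Gk: "norm (?G y) \<le> k" by (intro k) simp
    then have k0: "k \<ge> 0" using norm_ge_zero order_trans by blast
    have "norm (blinfun_apply (?G y) y) \<le> k * norm y"
      by (rule order_trans[OF norm_blinfun mult_right_mono[OF Gk norm_ge_zero]])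
    then have "norm (ip y y) \<le> (k * \<tau> y) * norm y"
      using True by (simp add: G field_simps)
    then have "norm y \<le> k * \<tau> y"
      by (rule norm_le_if_ip_le[rotated]) (use k0 True in simp)
    then have "(norm y)\<^sup>2 \<le> (k * \<tau> y)\<^sup>2" by (rule power_mono) simp
    also have "\<dots> = k\<^sup>2 * norm (ell2_ip (S y) (S y))" by (simp add: \<tau>_def power_mult_distrib)
    also have "\<dots> \<le> (k\<^sup>2 + 1) * norm (ell2_ip (S y) (S y))" by (rule mult_right_mono) simp_all
    finally show ?thesis .
  next
    case False
    then have "\<tau> y = 0" by (simp add: \<tau>_def)
    moreover obtain C where "norm (ip y y) \<le> C * \<tau> y" using \<tau> by blast
    ultimately have "y = 0" by (intro ip_self_eq_0[of y]) simp
    then show ?thesis by simp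
  qed
  moreover have "k\<^sup>2 + 1 > 0" by (rule add_nonneg_pos) simp_all
  ultimately show thesis by (rule that[rotated])
qed

lemma cstar_le_if_diff_eq_ip: "b - a = ip y y \<Longrightarrow> a \<preceq> b"
  using ip_self_pos[of y] by (simp add: cstar_le_def)

section \<open>Frame bounds\<close>

lemma frame_bounds_of_surjective:
  assumes adj: "is_adjoint ell2_ip ip T S" and "surj T"
  obtains A B where "A > 0" "B > 0" "\<And>x. A *\<^sub>R ip x x \<preceq> ell2_ip (S x) (S x)"
    "\<And>x. ell2_ip (S x) (S x) \<preceq> B *\<^sub>R ip x x"
proof -
  have TS: "ip (T (S x)) y = ell2_ip (S x) (S y)" "ip x (T (S y)) = ell2_ip (S x) (S y)" for x y
    using adj star_ell2_ip star_ip unfolding is_adjoint_def by metis+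
  define R where "R = Blinfun (\<lambda>x. T (S x))"
  have R: "R x = T (S x)" for x
    unfolding R_def by (subst bounded_linear_Blinfun_apply[OF bounded_linear_if_symmetric]) (simp_all add: TS)
  have sR: "selfadj ip R" by (rule selfadjI) (simp add: R TS)
  obtain k where k: "k > 0" "\<And>x. (norm x)\<^sup>2 \<le> k * norm (ell2_ip (S x) (S x))"
    using adjoint_bounded_below[OF assms] by blast
  define A where "A = 1 / (2 * k)"
  \<comment> \<open>Adding 1 keeps \<open>B\<close> positive even if \<open>R = 0\<close>.\<close>
  define B where "B = norm R + 1"
  have "A > 0" using k(1) by (simp add: A_def)
  have "B > 0" unfolding B_def by (rule add_nonneg_pos) simp_all
  have "positive_op ip (R - A *\<^sub>R id_blinfun)"
  proof (rule positive_op_if_negative_part_0)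
    show "selfadj ip (R - A *\<^sub>R id_blinfun)"
      by (intro selfadj_diff selfadj_scaleR selfadj_id sR)
    fix N G :: "'x \<Rightarrow>\<^sub>L 'x"
    assume N: "selfadj ip N" and G: "selfadj ip G"
      and NG: "\<And>x. N ((R - A *\<^sub>R id_blinfun) (N x)) = - G (G x)"
    have "N x = 0" for x
    proof -
      \<comment> \<open>On the range of \<open>N\<close>, the inner square of \<open>S (N x)\<close>
        is at most \<open>A\<close> times that of \<open>N x\<close>. With
        \<open>A = 1 / (2 * k)\<close> the lower bound \<open>k\<close> then makes the squared norm
        of \<open>N x\<close> at most half of itself.\<close>
      have "ip (N x) ((R - A *\<^sub>R id_blinfun) (N x)) = ip x (- G (G x))"
        unfolding selfadj_ip[OF N] NG ..
      then have "ell2_ip (S (N x)) (S (N x)) - A *\<^sub>R ip (N x) (N x) = - ip (G x) (G x)"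
        by (simp add: blinfun.bilinear_simps ip_diff_right ip_minus_right ip_scaleR_right R TS selfadj_ip[OF G])
      then have "A *\<^sub>R ip (N x) (N x) - ell2_ip (S (N x)) (S (N x)) = ip (G x) (G x)"
        by (metis minus_diff_eq minus_minus)
      then have "norm (ell2_ip (S (N x)) (S (N x))) \<le> norm (A *\<^sub>R ip (N x) (N x))"
        by (intro positive_elem_norm_mono[OF positive_elem_ell2_ip]) (simp add: positive_elem_ip)
      then have "norm (ell2_ip (S (N x)) (S (N x))) \<le> A * (norm (N x))\<^sup>2"
        using \<open>A > 0\<close> by (simp add: norm_power2)
      then have "k * norm (ell2_ip (S (N x)) (S (N x))) \<le> k * (A * (norm (N x))\<^sup>2)"
        using k(1) by (intro mult_left_mono) auto
      with k(2)[of "N x"] have "(norm (N x))\<^sup>2 \<le> k * (A * (norm (N x))\<^sup>2)" by linarith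
      also have "\<dots> = (norm (N x))\<^sup>2 / 2" using k(1) by (simp add: A_def)
      finally show ?thesis by simp
    qed
    then have "G (G x) = 0" for x using NG[of x] by (simp add: blinfun.bilinear_simps)
    then show "G = 0" by (rule selfadj_square_eq_0[OF G])
  qed
  then have lower: "A *\<^sub>R ip x x \<preceq> ell2_ip (S x) (S x)" for x
  proof -
    obtain y where "ip x ((R - A *\<^sub>R id_blinfun) x) = ip y y"
      using \<open>positive_op ip (R - A *\<^sub>R id_blinfun)\<close> by (rule ip_positive_op)
    then have "ell2_ip (S x) (S x) - A *\<^sub>R ip x x = ip y y"
      by (simp add: blinfun.bilinear_simps ip_diff_right ip_scaleR_right R TS)
    then show ?thesis by (rule cstar_le_if_diff_eq_ip)
  qed
  have upper: "ell2_ip (S x) (S x) \<preceq> B *\<^sub>R ip x x" for x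
  proof -
    have "positive_op ip (B *\<^sub>R id_blinfun - R)"
      unfolding positive_op_def
      by (intro conjI exI[of _ B] selfadj_diff selfadj_scaleR selfadj_id sR)
        (use \<open>B > 0\<close> in \<open>simp_all add: B_def\<close>)
    then obtain y where "ip x ((B *\<^sub>R id_blinfun - R) x) = ip y y"
      by (rule ip_positive_op)
    then have "B *\<^sub>R ip x x - ell2_ip (S x) (S x) = ip y y"
      by (simp add: blinfun.bilinear_simps ip_diff_right ip_scaleR_right R TS)
    then show ?thesis by (rule cstar_le_if_diff_eq_ip)
  qed
  show thesis using \<open>A > 0\<close> \<open>B > 0\<close> lower upper by (rule that)
qed

section \<open>Recovering the sequence from its synthesis operator\<close>

text \<open>\<open>synthesis\<close> is a definite description, so an adjoint of the analysis
  operator must first be exhibited. It is \<open>f \<mapsto> \<Sum>i. v i (f i)\<close>, whose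
  convergence comes from the upper frame bound.\<close>

lemma synthesis_single:
  assumes v: "\<And>n. v n \<in> multiplier_module ip"
    and summ: "\<And>x. summable (\<lambda>n. star (mult_ip ip (v n) x) * mult_ip ip (v n) x)"
    and B: "\<And>x. (\<Sum>n. star (mult_ip ip (v n) x) * mult_ip ip (v n) x) \<preceq> B *\<^sub>R ip x x" "B > 0"
  shows "synthesis ip v (ell2_single n a) = v n a"
proof -
  define V where "V n = mult_ip ip (v n)" for n
  have V: "ip (v n a) x = star a * V n x" for n a x
    using is_adjoint_adjoint_op[OF v[of n]]
    by (simp add: is_adjoint_def V_def mult_ip_def algebra_ip_def)
  have U: "Rep_ell2 (analysis ip v x) = (\<lambda>n. V n x)" for x
    unfolding analysis_def V_def by (intro Abs_ell2_inverse) (simp add: summ)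
  have bessel: "norm (\<Sum>n\<in>I. star (V n x) * V n x) \<le> B * (norm x)\<^sup>2" if "finite I" for I x
  proof -
    let ?s = "\<Sum>n. star (V n x) * V n x"
    have "norm (\<Sum>n\<in>I. star (V n x) * V n x) \<le> norm ?s"
      by (rule norm_sum_le_suminf[OF _ that]) (simp add: V_def summ)
    also have "norm ?s \<le> norm (B *\<^sub>R ip x x)"
    proof (rule positive_elem_norm_mono)
      show "positive_elem ?s"
        by (rule positive_elem_suminf[OF positive_elem_star_mult]) (simp add: V_def summ)
      show "positive_elem (B *\<^sub>R ip x x - ?s)"
        unfolding V_def by (rule cstar_le_imp_positive_elem[OF B(1)])
    qed
    finally show ?thesis using B(2) by (simp add: norm_power2)
  qed
  \<comment> \<open>With \<open>z\<close> the finite sum, \<open>ip z z\<close> pairs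
    \<open>h\<close> with the coefficients of \<open>z\<close>; Cauchy-Schwarz and
    \<open>bessel\<close> apply, and one factor of the squared norm of \<open>z\<close>
    cancels.\<close>
  have partial: "(norm (\<Sum>i\<in>I. v i (h i)))\<^sup>2 \<le> B * norm (\<Sum>i\<in>I. star (h i) * h i)"
    if I: "finite I" for I h
  proof -
    define z where "z = (\<Sum>i\<in>I. v i (h i))"
    have "ip z z = (\<Sum>i\<in>I. star (h i) * V i z)"
    proof -
      have "ip z z = (\<Sum>i\<in>I. ip (v i (h i)) z)"
        by (subst (1) z_def) (rule linear_sum[OF bounded_linear.linear[OF
          bounded_bilinear.bounded_linear_left[OF bounded_bilinear_ip]]])
      then show ?thesis by (simp add: V)
    qed
    then have "(norm (ip z z))\<^sup>2 \<le> norm (\<Sum>i\<in>I. star (h i) * h i) * norm (\<Sum>i\<in>I. star (V i z) * V i z)"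
      using cauchy_schwarz_sum[of h "\<lambda>i. V i z" I] by simp
    also have "\<dots> \<le> norm (\<Sum>i\<in>I. star (h i) * h i) * (B * (norm z)\<^sup>2)"
      by (intro mult_left_mono bessel I) simp
    finally have "(norm z)\<^sup>2 * (norm z)\<^sup>2 \<le> (B * norm (\<Sum>i\<in>I. star (h i) * h i)) * (norm z)\<^sup>2"
      unfolding norm_power2[symmetric] by (simp only: power2_eq_square mult_ac)
    then have "(norm z)\<^sup>2 \<le> B * norm (\<Sum>i\<in>I. star (h i) * h i)"
    proof (cases "z = 0")
      case False
      then have "(norm z)\<^sup>2 > 0" by simp
      with \<open>(norm z)\<^sup>2 * (norm z)\<^sup>2 \<le> _\<close> show ?thesis by (rule mult_right_le_imp_le)
    qed (use B(2) in simp)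
    then show ?thesis by (simp add: z_def)
  qed
  have summ_v: "summable (\<lambda>i. v i (Rep_ell2 f i))" for f
    unfolding summable_Cauchy
  proof (intro allI impI)
    fix e :: real assume e: "e > 0"
    then have "e\<^sup>2 / B > 0" using B(2) by simp
    then obtain M where M: "\<forall>m\<ge>M. \<forall>n. norm (\<Sum>i=m..<n. star (Rep_ell2 f i) * Rep_ell2 f i) < e\<^sup>2 / B"
      using summable_Rep_ell2[of f f] unfolding summable_Cauchy by blast
    have "norm (\<Sum>i=m..<n. v i (Rep_ell2 f i)) < e" if "m \<ge> M" for m n
    proof -
      have "B * norm (\<Sum>i=m..<n. star (Rep_ell2 f i) * Rep_ell2 f i) < e\<^sup>2"
        using M that B(2) by (simp add: pos_less_divide_eq mult.commute)
      then have "(norm (\<Sum>i=m..<n. v i (Rep_ell2 f i)))\<^sup>2 < e\<^sup>2"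
        by (rule le_less_trans[OF partial, rotated]) simp
      then show ?thesis by (rule power2_less_imp_less) (use e in simp)
    qed
    then show "\<exists>N. \<forall>m\<ge>N. \<forall>n. norm (\<Sum>i=m..<n. v i (Rep_ell2 f i)) < e" by blast
  qed
  have "is_adjoint ip ell2_ip (analysis ip v) (\<lambda>f. \<Sum>i. v i (Rep_ell2 f i))"
    unfolding is_adjoint_def
  proof (intro allI)
    fix x f
    have "ip (\<Sum>i. v i (Rep_ell2 f i)) x = (\<Sum>i. ip (v i (Rep_ell2 f i)) x)"
      by (rule bounded_linear.suminf[OF
            bounded_bilinear.bounded_linear_left[OF bounded_bilinear_ip] summ_v])
    also have "\<dots> = ell2_ip f (analysis ip v x)"
      by (simp add: V U ell2_ip_def)
    finally show "ell2_ip (analysis ip v x) f = ip x (\<Sum>i. v i (Rep_ell2 f i))"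
      by (metis star_ip star_ell2_ip)
  qed
  then have "synthesis ip v = (\<lambda>f. \<Sum>i. v i (Rep_ell2 f i))"
    unfolding synthesis_def by (rule adjoint_op_eq)
  moreover have "(\<Sum>i. v i (if i = n then a else 0)) = v n a"
  proof -
    \<comment> \<open>\<open>v i\<close> is merely a function, so that it fixes 0 is read off from
      its adjoint.\<close>
    have "ip x (v i 0) = 0" for i x
      by (metis V star_ip star_zero mult_zero_left)
    then have "v i 0 = 0" for i by (intro ip_ext[of "v i 0" 0]) simp
    then have "(\<lambda>i. v i (if i = n then a else 0)) = (\<lambda>i. if i = n then v i a else 0)" by auto
    then show ?thesis using sums_unique[OF sums_single[of n "\<lambda>i. v i a"]] by simp
  qed
  ultimately show ?thesis by (simp add: Rep_ell2_single)
qed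

text \<open>Brings frames to the form of the outer frame inequalities, so that both cases share one
  argument.\<close>

lemma is_frame_iff_mult_ip:
  "is_frame ip xs \<longleftrightarrow> (\<exists>A B :: real. A > 0 \<and> B > 0 \<and>
      (\<forall>x. let c = (\<lambda>n. mult_ip ip (mult_embed act (xs n)) x) in
           summable (\<lambda>n. star (c n) * c n) \<and> A *\<^sub>R ip x x \<preceq> (\<Sum>n. star (c n) * c n) \<and>
           (\<Sum>n. star (c n) * c n) \<preceq> B *\<^sub>R ip x x))"
  by (simp only: is_frame_def mult_ip_embed star_ip Let_def)

lemma synthesis_single_frame:
  assumes "(\<exists>xs. is_frame ip xs \<and> v = (\<lambda>n. mult_embed act (xs n))) \<or> is_outer_frame act ip v"
  shows "synthesis ip v (ell2_single n a) = v n a"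
proof -
  have "\<exists>B>0. \<forall>x.
      summable (\<lambda>n. star (mult_ip ip (v n) x) * mult_ip ip (v n) x) \<and>
      (\<Sum>n. star (mult_ip ip (v n) x) * mult_ip ip (v n) x) \<preceq> B *\<^sub>R ip x x"
    and v: "v n \<in> multiplier_module ip" for n
    using assms
    by (auto simp: is_frame_iff_mult_ip is_outer_frame_def Let_def embed_in_multiplier_module)
  then obtain B where B: "B > 0"
    "\<forall>x. summable (\<lambda>n. star (mult_ip ip (v n) x) * mult_ip ip (v n) x) \<and>
      (\<Sum>n. star (mult_ip ip (v n) x) * mult_ip ip (v n) x) \<preceq> B *\<^sub>R ip x x"
    by blast
  show ?thesis
    by (rule synthesis_single[OF v B(2)[THEN spec, THEN conjunct1] B(2)[THEN spec, THEN conjunct2] B(1)])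
qed

section \<open>Existence and uniqueness\<close>

theorem unique_frame_or_outer_frame:
  assumes "T \<in> adjointable ell2_ip ip" and "surj T"
  shows "\<exists>!v. ((\<exists>xs. is_frame ip xs \<and> v = (\<lambda>n. mult_embed act (xs n))) \<or> is_outer_frame act ip v) \<and>
    synthesis ip v = T"
proof -
  obtain S where S: "is_adjoint ell2_ip ip T S"
    using assms(1) by (auto simp: adjointable_def)
  define v where "v n a = T (ell2_single n a)" for n a
  have v: "is_adjoint algebra_ip ip (v n) (\<lambda>y. Rep_ell2 (S y) n)" for n
    using S by (simp add: is_adjoint_def v_def ell2_ip_single algebra_ip_def)
  have mult_v: "mult_ip ip (v n) y = Rep_ell2 (S y) n" for n y
    by (simp add: mult_ip_eqI(2)[OF v])
  obtain A B where AB: "A > 0" "B > 0" "\<And>x. A *\<^sub>R ip x x \<preceq> ell2_ip (S x) (S x)"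
    "\<And>x. ell2_ip (S x) (S x) \<preceq> B *\<^sub>R ip x x"
    using frame_bounds_of_surjective[OF S assms(2)] by blast
  have bounds: "\<exists>A B :: real. A > 0 \<and> B > 0 \<and>
      (\<forall>x. summable (\<lambda>n. star (Rep_ell2 (S x) n) * Rep_ell2 (S x) n) \<and>
           A *\<^sub>R ip x x \<preceq> (\<Sum>n. star (Rep_ell2 (S x) n) * Rep_ell2 (S x) n) \<and>
           (\<Sum>n. star (Rep_ell2 (S x) n) * Rep_ell2 (S x) n) \<preceq> B *\<^sub>R ip x x)"
    unfolding ell2_ip_def[symmetric]
    by (intro exI[of _ A] exI[of _ B] conjI allI AB summable_Rep_ell2)
  have "(\<exists>xs. is_frame ip xs \<and> v = (\<lambda>n. mult_embed act (xs n))) \<or> is_outer_frame act ip v"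
  \<comment> \<open>The inequalities are common to both cases; what decides is whether every
    multiplier comes from the module.\<close>
  proof (cases "\<forall>n. v n \<in> range (mult_embed act)")
    case True
    then have "\<forall>n. \<exists>x. v n = mult_embed act x" by blast
    then obtain xs where xs: "\<And>n. v n = mult_embed act (xs n)" by metis
    have "is_frame ip xs"
      unfolding is_frame_iff_mult_ip Let_def xs[symmetric] mult_v
      by (rule bounds)
    moreover have "v = (\<lambda>n. mult_embed act (xs n))" by (rule ext) (rule xs)
    ultimately show ?thesis by blast
  next
    case False
    then have "is_outer_frame act ip v"
      unfolding is_outer_frame_def mult_v
      by (intro conjI allI bounds mult_ip_eqI(1)[OF v]) simp
    then show ?thesis ..
  qed
  moreover have "synthesis ip v = T"
  proof -
    have an: "analysis ip v = S"
      by (rule ext) (simp add: analysis_def mult_v Rep_ell2_inverse)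
    have "is_adjoint ip ell2_ip S T"
      unfolding is_adjoint_def
    proof (intro allI)
      fix x f
      have "star (ip (T f) x) = star (ell2_ip f (S x))"
        using S by (simp add: is_adjoint_def)
      then show "ell2_ip (S x) f = ip x (T f)" by (simp only: star_ip star_ell2_ip)
    qed
    then show ?thesis unfolding synthesis_def an by (rule adjoint_op_eq)
  qed
  moreover have "w = v"
    if "((\<exists>xs. is_frame ip xs \<and> w = (\<lambda>n. mult_embed act (xs n))) \<or> is_outer_frame act ip w) \<and>
      synthesis ip w = T" for w
  proof (intro ext)
    fix n a
    \<comment> \<open>Any admissible sequence is determined by the values of its synthesis operator
      on the \<open>ell2_single n a\<close>.\<close>
    have "w n a = synthesis ip w (ell2_single n a)"
      by (rule synthesis_single_frame[OF conjunct1[OF that], symmetric])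
    then show "w n a = v n a" by (simp only: conjunct2[OF that] v_def)
  qed
  ultimately show ?thesis by (intro ex1I[of _ v] conjI)
qed

end

theorem theorem3p19:
  fixes act :: "'x::complex_banach \<Rightarrow> 'a::cstar_algebra \<Rightarrow> 'x"
    and ip :: "'x \<Rightarrow> 'x \<Rightarrow> 'a"
    and T :: "'a ell2 \<Rightarrow> 'x"
  assumes "hilbert_module act ip"
    and "T \<in> adjointable ell2_ip ip"
    and "surj T"
  shows "\<exists>!v :: nat \<Rightarrow> 'a \<Rightarrow> 'x.
           ((\<exists>xs. is_frame ip xs \<and> v = (\<lambda>n. mult_embed act (xs n))) \<or> is_outer_frame act ip v) \<and>
           synthesis ip v = T"
  using assms by (rule hilbert_module.unique_frame_or_outer_frame)

end
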